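(* Let $p\ge 1$ and let $f\in C^\infty(\mathbb{R}^{p+1})$. Let $\mathcal{M}_{6+4p,f}=(\mathbb{R}^{6+4p},g_{6+4p,f})$ be the pseudo-Riemannian manifold defined in the context. Then: \begin{enumerate} \item All geodesics in $\mathcal{M}_{6+4p,f}$ extend for infinite time. \item The exponential map $\exp_{P,\mathcal{M}_{6+4p,f}}:T_P\mathbb{R}^{6+4p}\to\mathbb{R}^{6+4p}$ is a diffeomorphism for all $P\in\mathbb{R}^{6+4p}$. \item For every $k\ge 0$, the non-zero components of $\nabla^kR$ (up to the usual symmetries of the curvature tensor and its covariant derivatives) are $$\nabla^kR(\partial_x,\partial_{\xi_1},\partial_{\xi_2},\partial_x;\partial_{\xi_3},\dots,\partial_{\xi_{k+2}})=-\tfrac12(\partial_{\xi_1}\cdots\partial_{\xi_{k+2}})\,g_{6+4p,f}(\partial_x,\partial_x)$$ for $\xi_i\in\{z_0,\dots,z_p,\tilde z_0,\dots,\tilde z_p\}$. \item All scalar Weyl invariants of $\mathcal{M}_{6+4p,f}$ vanish. \item $\mathcal{M}_{6+4p,f}$ is a symmetric space if and only if $f$ is at most quadratic (i.e. a polynomial of degree at most $2$). \end{enumerate}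
   Context: Let $(x,z_0,\dots,z_p,\tilde z_0,\dots,\tilde z_p,x^*,z_0^*,\dots,z_p^*,\tilde z_0^*,\dots,\tilde z_p^* )$ be coordinates on $\mathbb{R}^{6+4p}$. For a smooth function $f=f(z_0,\dots,z_p)$ on $\mathbb{R}^{p+1}$, the metric $g_{6+4p,f}$ of neutral signature $(3+2p,3+2p)$ is the one whose only non-zero components (up to symmetry) are $$g_{6+4p,f}(\partial_x,\partial_x)=-2\{f(z_0,\dots,z_p)+z_0\tilde z_0+\dots+z_p\tilde z_p\},$$ $$g_{6+4p,f}(\partial_x,\partial_{x^*})=g_{6+4p,f}(\partial_{z_i},\partial_{z_i^*})=g_{6+4p,f}(\partial_{\tilde z_i},\partial_{\tilde z_i^*})=1\quad(0\le i\le p).$$ Curvature convention: with $\nabla$ the Levi-Civita connection, $\mathcal{R}(\xi_1,\xi_2)\xi_3=(\nabla_{\xi_1}\nabla_{\xi_2}-\nabla_{\xi_2}\nabla_{\xi_1}-\nabla_{[\xi_1,\xi_2]})\xi_3$ and $R(\xi_1,\xi_2,\xi_3,\xi_4)=g(\mathcal{R}(\xi_1,\xi_2)\xi_3,\xi_4)$; $\nabla^kR$ is the $k$-th covariant derivative of $R$, with the differentiation slots written after the semicolon. Scalar Weyl invariants are the scalar functions obtained from the curvature tensor and its covariant derivatives by using the metric to contract all indices in pairs (for example the scalar curvature or $|\rho|^2$, $\rho$ the Ricci tensor). *)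

theory Defs
  imports "HOL-Analysis.Analysis"
begin

section \<open>Smooth maps\<close>

primrec Ck :: "nat \<Rightarrow> ('a::euclidean_space \<Rightarrow> 'b::real_normed_vector) \<Rightarrow> bool" where
  "Ck 0 F \<longleftrightarrow> continuous_on UNIV F"
| "Ck (Suc k) F \<longleftrightarrow>
     (\<forall>x. F differentiable (at x)) \<and> (\<forall>v. Ck k (\<lambda>x. frechet_derivative F (at x) v))"

definition smooth :: "('a::euclidean_space \<Rightarrow> 'b::real_normed_vector) \<Rightarrow> bool" where
  "smooth F \<longleftrightarrow> (\<forall>k. Ck k F)"

definition diffeomorphism :: "('a::euclidean_space \<Rightarrow> 'b::euclidean_space) \<Rightarrow> bool" where
  "diffeomorphism F \<longleftrightarrow> bij F \<and> smooth F \<and> smooth (inv F)"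

definition partial :: "'i::finite \<Rightarrow> (real^'i \<Rightarrow> real) \<Rightarrow> real^'i \<Rightarrow> real" where
  "partial i F P = frechet_derivative F (at P) (axis i 1)"


section \<open>Pseudo-Riemannian geometry in global coordinates\<close>

text \<open>A metric on the whole of \<open>real^'i\<close> is given by its matrix of components with respect to
  the coordinate frame; every tangent space is identified with the vector space itself.\<close>

type_synonym 'i metric = "real^'i \<Rightarrow> real^'i^'i"
type_synonym 'i vfield = "real^'i \<Rightarrow> real^'i"

definition ginner :: "'i::finite metric \<Rightarrow> real^'i \<Rightarrow> real^'i \<Rightarrow> real^'i \<Rightarrow> real" where
  "ginner g P u v = u \<bullet> (g P *v v)"

definition christoffel :: "'i::finite metric \<Rightarrow> real^'i \<Rightarrow> 'i \<Rightarrow> 'i \<Rightarrow> 'i \<Rightarrow> real" where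
  "christoffel g P k i j = (1/2) * (\<Sum>l\<in>UNIV. matrix_inv (g P) $ k $ l *
     (partial i (\<lambda>Q. g Q $ j $ l) P + partial j (\<lambda>Q. g Q $ i $ l) P - partial l (\<lambda>Q. g Q $ i $ j) P))"

definition christoffel_vec :: "'i::finite metric \<Rightarrow> real^'i \<Rightarrow> real^'i \<Rightarrow> real^'i \<Rightarrow> real^'i" where
  "christoffel_vec g P u v = (\<chi> k. \<Sum>i\<in>UNIV. \<Sum>j\<in>UNIV. christoffel g P k i j * u $ i * v $ j)"

text \<open>The Levi-Civita connection; the lemmas \<open>nabla_torsion_free\<close> and \<open>nabla_metric\<close> below
  give its characterising properties.\<close>

definition nabla :: "'i::finite metric \<Rightarrow> 'i vfield \<Rightarrow> 'i vfield \<Rightarrow> 'i vfield" where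
  "nabla g U V = (\<lambda>P. frechet_derivative V (at P) (U P) + christoffel_vec g P (U P) (V P))"

definition lie_bracket :: "'i::finite vfield \<Rightarrow> 'i vfield \<Rightarrow> 'i vfield" where
  "lie_bracket U V = (\<lambda>P. frechet_derivative V (at P) (U P) - frechet_derivative U (at P) (V P))"

definition curv_op :: "'i::finite metric \<Rightarrow> 'i vfield \<Rightarrow> 'i vfield \<Rightarrow> 'i vfield \<Rightarrow> 'i vfield" where
  "curv_op g U V W = (\<lambda>P. nabla g U (nabla g V W) P - nabla g V (nabla g U W) P
                          - nabla g (lie_bracket U V) W P)"

definition Riem :: "'i::finite metric \<Rightarrow> 'i vfield \<Rightarrow> 'i vfield \<Rightarrow> 'i vfield \<Rightarrow> 'i vfield \<Rightarrow> real^'i \<Rightarrow> real"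
  where "Riem g U V W Y P = ginner g P (curv_op g U V W P) (Y P)"

text \<open>A covariant tensor field is a map from lists of vector fields (its arguments) to functions.
  Covariant differentiation adds the direction of differentiation as a new last argument.\<close>

definition cov_deriv ::
  "'i::finite metric \<Rightarrow> ('i vfield list \<Rightarrow> real^'i \<Rightarrow> real) \<Rightarrow> ('i vfield list \<Rightarrow> real^'i \<Rightarrow> real)" where
  "cov_deriv g T Vs P =
     (let Ys = butlast Vs; W = last Vs in
        frechet_derivative (T Ys) (at P) (W P)
        - (\<Sum>j<length Ys. T (Ys[j := nabla g W (Ys ! j)]) P))"

primrec nabla_Riem :: "'i::finite metric \<Rightarrow> nat \<Rightarrow> 'i vfield list \<Rightarrow> real^'i \<Rightarrow> real" where
  "nabla_Riem g 0 = (\<lambda>Vs. Riem g (Vs ! 0) (Vs ! 1) (Vs ! 2) (Vs ! 3))"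
| "nabla_Riem g (Suc k) = cov_deriv g (nabla_Riem g k)"

definition coord_field :: "'i::finite \<Rightarrow> 'i vfield" where
  "coord_field i = (\<lambda>_. axis i 1)"

definition nabla_Riem_comp :: "'i::finite metric \<Rightarrow> nat \<Rightarrow> 'i list \<Rightarrow> real^'i \<Rightarrow> real" where
  "nabla_Riem_comp g k idx P = nabla_Riem g k (map coord_field idx) P"


subsection \<open>The connection is torsion-free and metric\<close>

lemma partial_expand:
  assumes "F differentiable (at P)"
  shows "frechet_derivative F (at P) u = (\<Sum>i\<in>UNIV. u $ i * partial i F P)"
proof -
  have lin: "linear (frechet_derivative F (at P))"
    using assms by (rule linear_frechet_derivative)
  have "u = (\<Sum>i\<in>UNIV. u $ i *\<^sub>R axis i 1)"
    using basis_expansion[of u] by (simp add: scalar_mult_eq_scaleR)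
  hence "frechet_derivative F (at P) u = frechet_derivative F (at P) (\<Sum>i\<in>UNIV. u $ i *\<^sub>R axis i 1)"
    by simp
  also have "\<dots> = (\<Sum>i\<in>UNIV. u $ i * partial i F P)"
    by (simp add: linear_sum[OF lin] linear_cmul[OF lin] partial_def)
  finally show ?thesis .
qed

lemma matrix_mult_matrix_inv:
  fixes A :: "real^'i^'i"
  assumes "invertible A"
  shows "A ** matrix_inv A = mat 1"
  using assms unfolding invertible_def matrix_inv_def by (rule someI2_ex) blast

lemma christoffel_vec_sym:
  assumes "\<And>Q. transpose (g Q) = g Q"
  shows "christoffel_vec g P u v = christoffel_vec g P v u"
proof -
  have s: "g Q $ i $ j = g Q $ j $ i" for Q i j
    by (metis assms transpose_def vec_lambda_beta)
  have "christoffel g P k i j = christoffel g P k j i" for k i j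
    unfolding christoffel_def using s[of _ i j] by (simp add: add.commute)
  hence "(\<Sum>i\<in>UNIV. \<Sum>j\<in>UNIV. christoffel g P k i j * u $ i * v $ j)
       = (\<Sum>i\<in>UNIV. \<Sum>j\<in>UNIV. christoffel g P k i j * v $ i * u $ j)" for k
    by (subst sum.swap) (simp add: mult_ac)
  thus ?thesis by (simp add: christoffel_vec_def)
qed

lemma nabla_torsion_free:
  assumes "\<And>Q. transpose (g Q) = g Q"
  shows "nabla g U V P - nabla g V U P = lie_bracket U V P"
  using christoffel_vec_sym[OF assms] by (simp add: nabla_def lie_bracket_def)

lemma ginner_christoffel:
  assumes "invertible (g P)"
  shows "ginner g P w (christoffel_vec g P u v) =
    (\<Sum>l\<in>UNIV. \<Sum>i\<in>UNIV. \<Sum>j\<in>UNIV. (1/2) * w $ l * u $ i * v $ j *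
     (partial i (\<lambda>Q. g Q $ j $ l) P + partial j (\<lambda>Q. g Q $ i $ l) P - partial l (\<lambda>Q. g Q $ i $ j) P))"
proof -
  define D where "D i j l = partial i (\<lambda>Q. g Q $ j $ l) P + partial j (\<lambda>Q. g Q $ i $ l) P
    - partial l (\<lambda>Q. g Q $ i $ j) P" for i j l
  define d where "d = (\<chi> l. \<Sum>i\<in>UNIV. \<Sum>j\<in>UNIV. (1/2) * u $ i * v $ j * D i j l)"
  have "christoffel_vec g P u v $ k = (matrix_inv (g P) *v d) $ k" for k
  proof -
    have "christoffel_vec g P u v $ k = (\<Sum>i\<in>UNIV. \<Sum>j\<in>UNIV. \<Sum>l\<in>UNIV.
        matrix_inv (g P) $ k $ l * ((1/2) * u $ i * v $ j * D i j l))"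
      by (simp add: christoffel_vec_def christoffel_def D_def sum_distrib_left sum_distrib_right mult_ac)
    also have "\<dots> = (\<Sum>i\<in>UNIV. \<Sum>l\<in>UNIV. \<Sum>j\<in>UNIV.
        matrix_inv (g P) $ k $ l * ((1/2) * u $ i * v $ j * D i j l))"
      by (intro sum.cong refl sum.swap)
    also have "\<dots> = (\<Sum>l\<in>UNIV. \<Sum>i\<in>UNIV. \<Sum>j\<in>UNIV.
        matrix_inv (g P) $ k $ l * ((1/2) * u $ i * v $ j * D i j l))"
      by (rule sum.swap)
    also have "\<dots> = (matrix_inv (g P) *v d) $ k"
      by (simp add: d_def matrix_vector_mult_def sum_distrib_left)
    finally show ?thesis .
  qed
  hence "christoffel_vec g P u v = matrix_inv (g P) *v d"
    by (simp add: vec_eq_iff)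
  hence "g P *v christoffel_vec g P u v = d"
    using assms by (simp add: matrix_vector_mul_assoc matrix_mult_matrix_inv)
  thus ?thesis
    by (simp add: ginner_def inner_vec_def d_def sum_distrib_left D_def mult_ac)
qed

lemma nabla_metric:
  assumes sym: "\<And>Q. transpose (g Q) = g Q" and inv: "invertible (g P)"
    and dg: "g differentiable (at P)"
    and dV: "V differentiable (at P)" and dW: "W differentiable (at P)"
  shows "frechet_derivative (\<lambda>Q. ginner g Q (V Q) (W Q)) (at P) (U P)
       = ginner g P (nabla g U V P) (W P) + ginner g P (V P) (nabla g U W P)"
proof -
  define u v w where "u = U P" and "v = V P" and "w = W P"
  define dVu dWu where "dVu = frechet_derivative V (at P) u" and "dWu = frechet_derivative W (at P) u"
  define dG where "dG = frechet_derivative g (at P)"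
  have hV: "(V has_derivative frechet_derivative V (at P)) (at P)"
    using dV frechet_derivative_works by blast
  have hW: "(W has_derivative frechet_derivative W (at P)) (at P)"
    using dW frechet_derivative_works by blast
  have hg: "(g has_derivative dG) (at P)"
    using dg frechet_derivative_works dG_def by blast
  have hgc: "((\<lambda>Q. g Q $ a $ b) has_derivative (\<lambda>h. dG h $ a $ b)) (at P)" for a b
    by (intro bounded_linear.has_derivative[OF bounded_linear_vec_nth] hg)
  have dGc: "dG u $ a $ b = (\<Sum>i\<in>UNIV. u $ i * partial i (\<lambda>Q. g Q $ a $ b) P)" for a b
  proof -
    have "(\<lambda>Q. g Q $ a $ b) differentiable (at P)"
      using hgc by (rule differentiableI)
    from partial_expand[OF this, of u] show ?thesis
      unfolding frechet_derivative_at[OF hgc[of a b], symmetric] .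
  qed
  have s: "g Q $ i $ j = g Q $ j $ i" for Q i j
    by (metis sym transpose_def vec_lambda_beta)
  have gs: "ginner g P x y = ginner g P y x" for x y
    by (metis dot_lmul_matrix ginner_def inner_commute sym transpose_matrix_vector)
  have ge: "ginner g Q x y = (\<Sum>a\<in>UNIV. \<Sum>b\<in>UNIV. x $ a * (g Q $ a $ b * y $ b))" for Q x y
    by (simp add: ginner_def inner_vec_def matrix_vector_mult_def sum_distrib_left)
  have "((\<lambda>Q. ginner g Q (V Q) (W Q)) has_derivative
      (\<lambda>h. \<Sum>a\<in>UNIV. \<Sum>b\<in>UNIV. V P $ a * (g P $ a $ b * frechet_derivative W (at P) h $ b + dG h $ a $ b * W P $ b)
         + frechet_derivative V (at P) h $ a * (g P $ a $ b * W P $ b))) (at P)"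
    unfolding ge
    by (intro has_derivative_sum has_derivative_mult hgc
         bounded_linear.has_derivative[OF bounded_linear_vec_nth] hV hW)
  from frechet_derivative_at[OF this, symmetric]
  have L: "frechet_derivative (\<lambda>Q. ginner g Q (V Q) (W Q)) (at P) u =
      ginner g P v dWu + ginner g P dVu w + (\<Sum>a\<in>UNIV. \<Sum>b\<in>UNIV. v $ a * dG u $ a $ b * w $ b)"
    by (simp add: ge dVu_def dWu_def v_def w_def algebra_simps sum.distrib)
  define p where "p i a b = partial i (\<lambda>Q. g Q $ a $ b) P" for i a b
  have ps: "p i a b = p i b a" for i a b unfolding p_def using s[of _ a b] by simp
  have c1: "ginner g P w (christoffel_vec g P u v) =
     (\<Sum>a\<in>UNIV. \<Sum>b\<in>UNIV. \<Sum>i\<in>UNIV. (1/2) * w $ b * u $ i * v $ a * (p i a b + p a i b - p b i a))"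
    unfolding ginner_christoffel[of g P w u v, OF inv] p_def
    by (rule trans[OF sum.cong[OF refl sum.swap] sum.swap])
  have c2: "ginner g P v (christoffel_vec g P u w) =
     (\<Sum>a\<in>UNIV. \<Sum>b\<in>UNIV. \<Sum>i\<in>UNIV. (1/2) * v $ a * u $ i * w $ b * (p i b a + p b i a - p a i b))"
    unfolding ginner_christoffel[of g P v u w, OF inv] p_def
    by (rule sum.cong[OF refl sum.swap])
  have "ginner g P w (christoffel_vec g P u v) + ginner g P v (christoffel_vec g P u w) =
     (\<Sum>a\<in>UNIV. \<Sum>b\<in>UNIV. \<Sum>i\<in>UNIV. v $ a * u $ i * w $ b * p i a b)"
    unfolding c1 c2 sum.distrib[symmetric]
  proof (intro sum.cong refl)
    fix a b i
    show "(1/2) * w $ b * u $ i * v $ a * (p i a b + p a i b - p b i a)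
        + (1/2) * v $ a * u $ i * w $ b * (p i b a + p b i a - p a i b)
        = v $ a * u $ i * w $ b * p i a b"
      unfolding ps[of i b a] by (simp add: field_simps)
  qed
  also have "\<dots> = (\<Sum>a\<in>UNIV. \<Sum>b\<in>UNIV. v $ a * dG u $ a $ b * w $ b)"
    unfolding dGc p_def by (simp add: sum_distrib_left sum_distrib_right mult_ac)
  finally have C: "ginner g P w (christoffel_vec g P u v) + ginner g P v (christoffel_vec g P u w) =
     (\<Sum>a\<in>UNIV. \<Sum>b\<in>UNIV. v $ a * dG u $ a $ b * w $ b)" .
  have "ginner g P (nabla g U V P) w + ginner g P v (nabla g U W P) =
     ginner g P dVu w + ginner g P (christoffel_vec g P u v) w
     + ginner g P v dWu + ginner g P v (christoffel_vec g P u w)"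
    by (simp add: ginner_def nabla_def u_def v_def w_def dVu_def dWu_def inner_add_left
        inner_add_right matrix_vector_right_distrib)
  with L C gs[of "christoffel_vec g P u v" w] show ?thesis
    by (simp add: u_def v_def w_def)
qed


section \<open>Geodesics, exponential map, isometries\<close>

definition is_geodesic :: "'i::finite metric \<Rightarrow> real set \<Rightarrow> (real \<Rightarrow> real^'i) \<Rightarrow> bool" where
  "is_geodesic g J \<gamma> \<longleftrightarrow>
     (\<exists>v. \<forall>t\<in>J. (\<gamma> has_vector_derivative v t) (at t) \<and>
               (v has_vector_derivative - christoffel_vec g (\<gamma> t) (v t) (v t)) (at t))"

definition geodesically_complete :: "'i::finite metric \<Rightarrow> bool" where
  "geodesically_complete g \<longleftrightarrow>
     (\<forall>J \<gamma>. open J \<and> is_interval J \<and> is_geodesic g J \<gamma> \<longrightarrow>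
        (\<exists>\<gamma>'. is_geodesic g UNIV \<gamma>' \<and> (\<forall>t\<in>J. \<gamma>' t = \<gamma> t)))"

text \<open>\<open>exp_rel g P v Q\<close>: a geodesic that starts at \<open>P\<close> with velocity \<open>v\<close> is defined up to time 1
  and is then at \<open>Q\<close>.\<close>

definition exp_rel :: "'i::finite metric \<Rightarrow> real^'i \<Rightarrow> real^'i \<Rightarrow> real^'i \<Rightarrow> bool" where
  "exp_rel g P v Q \<longleftrightarrow>
     (\<exists>J \<gamma>. open J \<and> is_interval J \<and> {0..1} \<subseteq> J \<and> is_geodesic g J \<gamma> \<and>
           \<gamma> 0 = P \<and> (\<gamma> has_vector_derivative v) (at 0) \<and> \<gamma> 1 = Q)"

definition exp_dom :: "'i::finite metric \<Rightarrow> real^'i \<Rightarrow> (real^'i) set" where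
  "exp_dom g P = {v. \<exists>Q. exp_rel g P v Q}"

definition exp_map :: "'i::finite metric \<Rightarrow> real^'i \<Rightarrow> real^'i \<Rightarrow> real^'i" where
  "exp_map g P v = (THE Q. exp_rel g P v Q)"

definition isometry :: "'i::finite metric \<Rightarrow> (real^'i \<Rightarrow> real^'i) \<Rightarrow> bool" where
  "isometry g \<phi> \<longleftrightarrow> diffeomorphism \<phi> \<and>
     (\<forall>P u v. ginner g (\<phi> P) (frechet_derivative \<phi> (at P) u) (frechet_derivative \<phi> (at P) v)
              = ginner g P u v)"

definition symmetric_space :: "'i::finite metric \<Rightarrow> bool" where
  "symmetric_space g \<longleftrightarrow>
     (\<forall>P. \<exists>s. isometry g s \<and> s P = P \<and> (\<forall>v. frechet_derivative s (at P) v = - v))"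

definition locally_symmetric :: "'i::finite metric \<Rightarrow> bool" where
  "locally_symmetric g \<longleftrightarrow> (\<forall>idx P. length idx = 5 \<longrightarrow> nabla_Riem_comp g 1 idx P = 0)"


section \<open>Scalar Weyl invariants\<close>

text \<open>Components of the tensor product of the tensors
  \<open>\<nabla>\<^sup>kR\<close>, \<open>k\<close> ranging over the list \<open>ks\<close>, which has \<open>weyl_rank ks\<close> indices.\<close>

definition weyl_rank :: "nat list \<Rightarrow> nat" where
  "weyl_rank ks = (\<Sum>k\<leftarrow>ks. k + 4)"

primrec weyl_prod :: "'i::finite metric \<Rightarrow> nat list \<Rightarrow> 'i list \<Rightarrow> real^'i \<Rightarrow> real" where
  "weyl_prod g [] idx P = 1"
| "weyl_prod g (k # ks) idx P =
     nabla_Riem_comp g k (take (k + 4) idx) P * weyl_prod g ks (drop (k + 4) idx) P"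

text \<open>A complete pairing of the index positions \<open>0, \<dots>, n - 1\<close>.\<close>

definition index_pairing :: "nat \<Rightarrow> (nat \<times> nat) list \<Rightarrow> bool" where
  "index_pairing n ps \<longleftrightarrow>
     distinct (map fst ps @ map snd ps) \<and> set (map fst ps @ map snd ps) = {..<n}"

definition weyl_contraction ::
  "'i::finite metric \<Rightarrow> nat list \<Rightarrow> (nat \<times> nat) list \<Rightarrow> real^'i \<Rightarrow> real" where
  "weyl_contraction g ks ps P =
     (\<Sum>idx | length idx = weyl_rank ks.
        (\<Prod>(a, b)\<leftarrow>ps. matrix_inv (g P) $ (idx ! a) $ (idx ! b)) * weyl_prod g ks idx P)"

text \<open>Constants, i.e. the contractions of the empty product, are not counted.\<close>

inductive_set weyl_invariants :: "'i::finite metric \<Rightarrow> (real^'i \<Rightarrow> real) set"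
  for g :: "'i metric" where
  contraction: "\<lbrakk>ks \<noteq> []; index_pairing (weyl_rank ks) ps\<rbrakk>
     \<Longrightarrow> weyl_contraction g ks ps \<in> weyl_invariants g"
| add: "\<lbrakk>F \<in> weyl_invariants g; G \<in> weyl_invariants g\<rbrakk> \<Longrightarrow> (\<lambda>P. F P + G P) \<in> weyl_invariants g"
| scale: "F \<in> weyl_invariants g \<Longrightarrow> (\<lambda>P. c * F P) \<in> weyl_invariants g"


section \<open>The manifold\<close>

text \<open>The coordinates, in the order \<open>x\<close>, \<open>z\<^sub>i\<close>, \<open>z\<^sub>i\<close> with a tilde, and the starred
  versions of these. The index set \<open>{0, \<dots>, p}\<close> is replaced by a type \<open>'n\<close> with \<open>p + 1\<close> elements.\<close>

datatype 'n coord = cX | cZ 'n | cT 'n | cXs | cZs 'n | cTs 'n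

lemma UNIV_coord:
  "(UNIV :: 'n coord set) = {cX, cXs} \<union> range cZ \<union> range cT \<union> range cZs \<union> range cTs"
  (is "_ = ?S")
proof -
  have "c \<in> ?S" for c :: "'n coord" by (cases c) auto
  thus ?thesis by blast
qed

instance coord :: (finite) finite
  by standard (simp add: UNIV_coord)

lemma sum_UNIV_coord:
  fixes h :: "'n::finite coord \<Rightarrow> 'b::comm_monoid_add"
  shows "(\<Sum>c\<in>UNIV. h c) = h cX + h cXs + (\<Sum>i\<in>UNIV. h (cZ i)) + (\<Sum>i\<in>UNIV. h (cT i))
    + (\<Sum>i\<in>UNIV. h (cZs i)) + (\<Sum>i\<in>UNIV. h (cTs i))"
proof -
  have inj: "inj cZ" "inj cT" "inj cZs" "inj cTs" by (auto simp: inj_def)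
  have d: "({cX, cXs} \<union> range cZ \<union> range cT \<union> range cZs) \<inter> range cTs = {}"
    "({cX, cXs} \<union> range cZ \<union> range cT) \<inter> range cZs = {}"
    "({cX, cXs} \<union> range cZ) \<inter> range cT = {}" "{cX, cXs} \<inter> range cZ = {}" by auto
  show ?thesis
    unfolding UNIV_coord
    by (simp add: sum.union_disjoint d[unfolded insert_is_Un[of cX "{cXs}"], simplified] d
        sum.reindex inj del: Un_insert_left)
qed

lemma card_coord: "CARD('n::finite) = p + 1 \<Longrightarrow> CARD('n coord) = 6 + 4 * p"
  using sum_UNIV_coord[where 'n='n, of "\<lambda>_. 1::nat"] by simp

definition gM_xx :: "(real^'n::finite \<Rightarrow> real) \<Rightarrow> real^('n coord) \<Rightarrow> real" where
  "gM_xx f P = - 2 * (f (\<chi> i. P $ cZ i) + (\<Sum>i\<in>UNIV. P $ cZ i * P $ cT i))"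

fun gM_comp :: "(real^'n::finite \<Rightarrow> real) \<Rightarrow> real^('n coord) \<Rightarrow> 'n coord \<Rightarrow> 'n coord \<Rightarrow> real" where
  "gM_comp f P cX cX = gM_xx f P"
| "gM_comp f P cX cXs = 1"
| "gM_comp f P cXs cX = 1"
| "gM_comp f P (cZ i) (cZs j) = (if i = j then 1 else 0)"
| "gM_comp f P (cZs i) (cZ j) = (if i = j then 1 else 0)"
| "gM_comp f P (cT i) (cTs j) = (if i = j then 1 else 0)"
| "gM_comp f P (cTs i) (cT j) = (if i = j then 1 else 0)"
| "gM_comp f P _ _ = 0"

definition gM :: "(real^'n::finite \<Rightarrow> real) \<Rightarrow> 'n coord metric" where
  "gM f P = (\<chi> a b. gM_comp f P a b)"

lemma gM_symmetric: "transpose (gM f P) = gM f P"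
proof -
  have "gM_comp f P a b = gM_comp f P b a" for a b
    by (cases a; cases b) auto
  thus ?thesis by (simp add: gM_def transpose_def)
qed

lemma gM_invertible: "invertible (gM f P)"
proof -
  have "gM f P *v v = 0 \<Longrightarrow> v = 0" for v
  proof -
    assume 0: "gM f P *v v = 0"
    have r: "(\<Sum>c\<in>UNIV. gM_comp f P a c * v $ c) = 0" for a
      using arg_cong[OF 0, of "\<lambda>w. w $ a"] by (simp add: gM_def matrix_vector_mult_def)
    have "v $ cX = 0" using r[of cXs] by (simp add: sum_UNIV_coord)
    moreover have "v $ cXs = 0" using r[of cX] \<open>v $ cX = 0\<close> by (simp add: sum_UNIV_coord)
    moreover have "v $ cZ i = 0" for i using r[of "cZs i"] by (simp add: sum_UNIV_coord if_distrib[of "\<lambda>x. x * _"] cong: if_cong)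
    moreover have "v $ cT i = 0" for i using r[of "cTs i"] by (simp add: sum_UNIV_coord if_distrib[of "\<lambda>x. x * _"] cong: if_cong)
    moreover have "v $ cZs i = 0" for i using r[of "cZ i"] by (simp add: sum_UNIV_coord if_distrib[of "\<lambda>x. x * _"] cong: if_cong)
    moreover have "v $ cTs i = 0" for i using r[of "cT i"] by (simp add: sum_UNIV_coord if_distrib[of "\<lambda>x. x * _"] cong: if_cong)
    ultimately have "v $ c = 0" for c by (cases c) auto
    thus "v = 0" by (simp add: vec_eq_iff)
  qed
  thus ?thesis
    by (simp add: invertible_left_inverse matrix_left_invertible_ker)
qed

definition at_most_quadratic :: "(real^'n::finite \<Rightarrow> real) \<Rightarrow> bool" where
  "at_most_quadratic f \<longleftrightarrow>
     (\<exists>c b A. \<forall>z. f z = c + (\<Sum>i\<in>UNIV. b i * z $ i) + (\<Sum>i\<in>UNIV. \<Sum>j\<in>UNIV. A i j * z $ i * z $ j))"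

end

theory Submission
  imports Defs
begin

text \<open>The coefficient \<open>H = g(\<partial>\<^sub>x, \<partial>\<^sub>x)\<close> depends only on the coordinates \<open>z\<^sub>i\<close> and \<open>z\<^sub>i\<close> with a tilde
  (the base coordinates). All Christoffel symbols take values in the span of the starred
  directions, and they vanish as soon as one argument lies in this span. Hence the unstarred
  coordinates of a geodesic are affine, the starred ones are obtained by integrating a known
  function twice, and \<open>exp\<^sub>P v\<close> is \<open>P + v\<close> plus a starred vector that depends only on the unstarred
  part of \<open>v\<close>. For the same reason all products disappear from the curvature and its covariant
  derivatives, and only iterated partial derivatives of \<open>H\<close> are left. Since the inverse metric pairs
  no two unstarred indices, all Weyl invariants vanish.

  An isometry that reflects the tangent space at \<open>P\<close> is the conjugate of \<open>-1\<close> by the exponential map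
  at \<open>P\<close>. Being an isometry, it forces the integral of
  \<open>s (1 - s) (\<partial>\<^sub>b\<partial>\<^sub>cH(P + s w) - \<partial>\<^sub>b\<partial>\<^sub>cH(P - s w))\<close> over \<open>0 \<le> s \<le> 1\<close> to be zero for all \<open>w\<close>, and
  differentiation at \<open>w = 0\<close> shows that the third derivatives of \<open>H\<close> vanish at \<open>P\<close>. Conversely, if \<open>f\<close>
  is at most quadratic, then \<open>P + w \<mapsto> P - w - \<Gamma>\<^sub>P(w, w)\<close> is such an isometry.\<close>

section \<open>Calculus of smooth maps\<close>

definition dirderiv :: "'a::euclidean_space \<Rightarrow> ('a \<Rightarrow> 'b::real_normed_vector) \<Rightarrow> 'a \<Rightarrow> 'b" where
  "dirderiv v F x = frechet_derivative F (at x) v"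

lemma Ck_Suc_iff: "Ck (Suc k) F \<longleftrightarrow> (\<forall>x. F differentiable (at x)) \<and> (\<forall>v. Ck k (dirderiv v F))"
proof -
  have "dirderiv v F = (\<lambda>x. frechet_derivative F (at x) v)" for v
    by (rule ext) (simp add: dirderiv_def)
  thus ?thesis by simp
qed

declare Ck.simps(2) [simp del]

lemma has_derivative_dirderiv:
  "F differentiable (at x) \<Longrightarrow> (F has_derivative (\<lambda>v. dirderiv v F x)) (at x)"
  unfolding dirderiv_def by (simp add: frechet_derivative_works)

lemma dirderiv_eqI: "(F has_derivative F') (at x) \<Longrightarrow> dirderiv v F x = F' v"
  unfolding dirderiv_def using frechet_derivative_at by metis

text \<open>Reduces class \<open>Suc k\<close> to one explicit derivative formula, which is how the
  closure proofs by induction on \<open>k\<close> proceed.\<close>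

lemma Ck_SucI:
  assumes "\<And>x. (F has_derivative (\<lambda>v. F' v x)) (at x)" "\<And>v. Ck k (F' v)"
  shows "Ck (Suc k) F"
proof -
  have "dirderiv v F = F' v" for v
    using dirderiv_eqI[OF assms(1)] by (rule ext)
  thus ?thesis
    using assms by (auto simp: Ck_Suc_iff differentiable_def)
qed

lemma Ck_SucD:
  assumes "Ck (Suc k) F"
  shows "F differentiable (at x)" "(F has_derivative (\<lambda>v. dirderiv v F x)) (at x)" "Ck k (dirderiv v F)"
  using assms has_derivative_dirderiv unfolding Ck_Suc_iff by blast+

lemma Ck_decr: "Ck (Suc k) F \<Longrightarrow> Ck k F"
proof (induction k arbitrary: F)
  case 0
  thus ?case
    by (auto simp: Ck_Suc_iff intro!: continuous_at_imp_continuous_on differentiable_imp_continuous_within)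
next
  case (Suc k)
  thus ?case unfolding Ck_Suc_iff[of "Suc k" F] by (simp add: Ck_Suc_iff[of k F])
qed

lemma Ck_const: "Ck k (\<lambda>_. c)"
  by (induction k arbitrary: c) (auto intro!: Ck_SucI[where F'="\<lambda>_ _. 0"])

lemma Ck_bounded_linear_comp: "bounded_linear L \<Longrightarrow> Ck k F \<Longrightarrow> Ck k (\<lambda>x. L (F x))"
proof (induction k arbitrary: F)
  case 0
  thus ?case by (simp add: bounded_linear.continuous_on)
next
  case (Suc k)
  show ?case
    by (rule Ck_SucI) (rule bounded_linear.has_derivative[OF Suc.prems(1) Ck_SucD(2)[OF Suc.prems(2)]],
        rule Suc.IH[OF Suc.prems(1) Ck_SucD(3)[OF Suc.prems(2)]])
qed

lemma Ck_bounded_linear: "bounded_linear L \<Longrightarrow> Ck k L"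
proof (cases k)
  case 0
  assume "bounded_linear L" thus ?thesis by (simp add: 0 linear_continuous_on)
next
  case (Suc m)
  assume "bounded_linear L"
  thus ?thesis unfolding Suc
    by (intro Ck_SucI[where F'="\<lambda>v _. L v"] Ck_const) (rule bounded_linear_imp_has_derivative)
qed

lemma Ck_add: "Ck k F \<Longrightarrow> Ck k G \<Longrightarrow> Ck k (\<lambda>x. F x + G x)"
proof (induction k arbitrary: F G)
  case 0
  thus ?case by (auto intro: continuous_on_add)
next
  case (Suc k)
  show ?case
    by (rule Ck_SucI) (rule has_derivative_add[OF Ck_SucD(2)[OF Suc.prems(1)] Ck_SucD(2)[OF Suc.prems(2)]],
        rule Suc.IH[OF Ck_SucD(3)[OF Suc.prems(1)] Ck_SucD(3)[OF Suc.prems(2)]])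
qed

lemma Ck_bilinear:
  assumes "bounded_bilinear B"
  shows "Ck k F \<Longrightarrow> Ck k G \<Longrightarrow> Ck k (\<lambda>x. B (F x) (G x))"
proof (induction k arbitrary: F G)
  case 0
  thus ?case by (simp add: bounded_bilinear.continuous_on[OF assms])
next
  case (Suc k)
  \<comment> \<open>The product rule keeps one factor undifferentiated; \<open>Ck_decr\<close>
    lowers its class to match the derivative of the other.\<close>
  show ?case
    by (rule Ck_SucI)
      (rule bounded_bilinear.FDERIV[OF assms Ck_SucD(2)[OF Suc.prems(1)] Ck_SucD(2)[OF Suc.prems(2)]],
       intro Ck_add Suc.IH Ck_decr[OF Suc.prems(1)] Ck_decr[OF Suc.prems(2)]
         Ck_SucD(3)[OF Suc.prems(1)] Ck_SucD(3)[OF Suc.prems(2)])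
qed

text \<open>Differentiation only changes the direction from \<open>v\<close> to \<open>L v\<close>,
  so the induction stays among composites with the same affine map.\<close>

lemma Ck_affine_comp:
  assumes "bounded_linear L"
  shows "Ck k F \<Longrightarrow> Ck k (\<lambda>x. F (a + L x))"
proof (induction k arbitrary: F)
  case 0
  thus ?case
    by (auto intro!: continuous_on_compose2[of UNIV F UNIV "\<lambda>x. a + L x"] continuous_on_add
        linear_continuous_on[OF assms])
next
  case (Suc k)
  have "((\<lambda>x. F (a + L x)) has_derivative (\<lambda>v. dirderiv (L v) F (a + L x))) (at x)" for x
    by (rule has_derivative_compose[OF _ Ck_SucD(2)[OF Suc.prems], of "\<lambda>x. a + L x" L])
      (auto intro!: derivative_eq_intros bounded_linear_imp_has_derivative assms)
  thus ?case
    by (rule Ck_SucI) (rule Suc.IH[OF Ck_SucD(3)[OF Suc.prems]])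
qed

section \<open>Smooth maps and rules for directional derivatives\<close>

lemma smooth_iff: "smooth F \<longleftrightarrow> (\<forall>x. F differentiable (at x)) \<and> (\<forall>v. smooth (dirderiv v F))"
proof
  assume *: "smooth F"
  hence "Ck (Suc k) F" for k by (simp add: smooth_def)
  thus "(\<forall>x. F differentiable (at x)) \<and> (\<forall>v. smooth (dirderiv v F))"
    by (simp add: Ck_Suc_iff smooth_def)
next
  assume *: "(\<forall>x. F differentiable (at x)) \<and> (\<forall>v. smooth (dirderiv v F))"
  hence "Ck (Suc k) F" for k by (simp add: Ck_Suc_iff smooth_def)
  thus "smooth F" unfolding smooth_def using Ck_decr by blast
qed

lemma smooth_differentiable: "smooth F \<Longrightarrow> F differentiable (at x)"
  and smooth_dirderiv: "smooth F \<Longrightarrow> smooth (dirderiv v F)"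
  using smooth_iff by blast+

lemma smooth_has_derivative: "smooth F \<Longrightarrow> (F has_derivative (\<lambda>v. dirderiv v F x)) (at x)"
  by (simp add: has_derivative_dirderiv smooth_differentiable)

lemma smooth_continuous_on: "smooth F \<Longrightarrow> continuous_on S F"
  unfolding smooth_def using Ck.simps(1) continuous_on_subset by blast

lemma smooth_const: "smooth (\<lambda>_. c)"
  by (simp add: smooth_def Ck_const)

lemma smooth_bounded_linear: "bounded_linear L \<Longrightarrow> smooth L"
  by (simp add: smooth_def Ck_bounded_linear)

lemma smooth_bounded_linear_comp: "bounded_linear L \<Longrightarrow> smooth F \<Longrightarrow> smooth (\<lambda>x. L (F x))"
  by (simp add: smooth_def Ck_bounded_linear_comp)

lemma smooth_affine_comp: "bounded_linear L \<Longrightarrow> smooth F \<Longrightarrow> smooth (\<lambda>x. F (a + L x))"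
  by (simp add: smooth_def Ck_affine_comp)

lemma smooth_add: "smooth F \<Longrightarrow> smooth G \<Longrightarrow> smooth (\<lambda>x. F x + G x)"
  by (simp add: smooth_def Ck_add)

lemma smooth_mult: "smooth F \<Longrightarrow> smooth G \<Longrightarrow> smooth (\<lambda>x. F x * G x :: real)"
  by (simp add: smooth_def Ck_bilinear[OF bounded_bilinear_mult])

lemma smooth_scaleR: "smooth F \<Longrightarrow> smooth G \<Longrightarrow> smooth (\<lambda>x. F x *\<^sub>R G x)"
  by (simp add: smooth_def Ck_bilinear[OF bounded_bilinear_scaleR])

lemma smooth_minus: "smooth F \<Longrightarrow> smooth (\<lambda>x. - F x)"
  by (rule smooth_bounded_linear_comp[OF bounded_linear_minus[OF bounded_linear_ident]])

lemma smooth_diff: "smooth F \<Longrightarrow> smooth G \<Longrightarrow> smooth (\<lambda>x. F x - G x)"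
  using smooth_add[OF _ smooth_minus, of F G] by simp

lemma smooth_sum: "(\<And>i. i \<in> A \<Longrightarrow> smooth (F i)) \<Longrightarrow> smooth (\<lambda>x. \<Sum>i\<in>A. F i x)"
  by (induction A rule: infinite_finite_induct) (auto intro: smooth_const smooth_add)

lemma smooth_nth: "smooth F \<Longrightarrow> smooth (\<lambda>x. F x $ i)"
  by (rule smooth_bounded_linear_comp[OF bounded_linear_vec_nth])

lemma smooth_ident: "smooth (\<lambda>x. x)"
  by (rule smooth_bounded_linear) (rule bounded_linear_ident)

lemma vec_sum_axis: "(v :: real^'i::finite) = (\<Sum>i\<in>UNIV. v $ i *\<^sub>R axis i 1)"
  using basis_expansion[of v] by (simp add: scalar_mult_eq_scaleR)

lemma smooth_vec:
  fixes F :: "'a::euclidean_space \<Rightarrow> real^'i::finite"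
  assumes "\<And>i. smooth (\<lambda>x. F x $ i)"
  shows "smooth F"
proof -
  have *: "F = (\<lambda>x. \<Sum>i\<in>UNIV. F x $ i *\<^sub>R axis i 1)"
    by (rule ext) (rule vec_sum_axis)
  show ?thesis
    by (subst *) (intro smooth_sum smooth_scaleR smooth_const assms)
qed

lemmas smooth_intros = smooth_const smooth_ident smooth_add smooth_diff smooth_minus smooth_mult
  smooth_scaleR smooth_sum smooth_nth smooth_dirderiv

lemma dirderiv_add_dir: "F differentiable (at x) \<Longrightarrow> dirderiv (u + v) F x = dirderiv u F x + dirderiv v F x"
  and dirderiv_scaleR_dir: "F differentiable (at x) \<Longrightarrow> dirderiv (r *\<^sub>R v) F x = r *\<^sub>R dirderiv v F x"
  and dirderiv_minus_dir: "F differentiable (at x) \<Longrightarrow> dirderiv (- v) F x = - dirderiv v F x"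
  and dirderiv_diff_dir: "F differentiable (at x) \<Longrightarrow> dirderiv (u - v) F x = dirderiv u F x - dirderiv v F x"
  and dirderiv_sum_dir: "F differentiable (at x) \<Longrightarrow> dirderiv (\<Sum>i\<in>A. h i) F x = (\<Sum>i\<in>A. dirderiv (h i) F x)"
  and dirderiv_zero_dir: "F differentiable (at x) \<Longrightarrow> dirderiv 0 F x = 0"
  unfolding dirderiv_def using linear_frechet_derivative[of F "at x"]
  by (simp_all add: linear_add linear_cmul linear_neg linear_diff linear_sum linear_0)

lemma dirderiv_expand:
  fixes F :: "real^'i::finite \<Rightarrow> 'b::real_normed_vector"
  assumes "F differentiable (at x)"
  shows "dirderiv v F x = (\<Sum>i\<in>UNIV. v $ i *\<^sub>R dirderiv (axis i 1) F x)"
  by (subst vec_sum_axis[of v]) (simp add: dirderiv_sum_dir dirderiv_scaleR_dir assms)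

text \<open>A direction that moves with the point is expanded along the axes, which leaves smooth
  coefficients and derivatives in fixed directions.\<close>

lemma smooth_dirderiv_field:
  fixes F :: "real^'i::finite \<Rightarrow> 'b::euclidean_space"
  assumes "smooth F" "smooth V"
  shows "smooth (\<lambda>x. dirderiv (V x) F x)"
  by (subst dirderiv_expand[OF smooth_differentiable[OF assms(1)]]) (intro smooth_intros assms)

lemma dirderiv_add: "smooth F \<Longrightarrow> smooth G \<Longrightarrow> dirderiv v (\<lambda>x. F x + G x) x = dirderiv v F x + dirderiv v G x"
  by (rule dirderiv_eqI) (intro has_derivative_add smooth_has_derivative)

lemma dirderiv_diff: "smooth F \<Longrightarrow> smooth G \<Longrightarrow> dirderiv v (\<lambda>x. F x - G x) x = dirderiv v F x - dirderiv v G x"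
  by (rule dirderiv_eqI) (intro has_derivative_diff smooth_has_derivative)

lemma dirderiv_mult:
  "smooth F \<Longrightarrow> smooth G \<Longrightarrow> dirderiv v (\<lambda>x. F x * G x :: real) x = F x * dirderiv v G x + dirderiv v F x * G x"
  by (rule dirderiv_eqI) (intro has_derivative_mult smooth_has_derivative)

lemma dirderiv_scaleR:
  "smooth F \<Longrightarrow> smooth G \<Longrightarrow> dirderiv v (\<lambda>x. F x *\<^sub>R G x) x = F x *\<^sub>R dirderiv v G x + dirderiv v F x *\<^sub>R G x"
  by (rule dirderiv_eqI) (intro has_derivative_scaleR smooth_has_derivative)

lemma dirderiv_sum:
  "(\<And>i. i \<in> A \<Longrightarrow> smooth (F i)) \<Longrightarrow> dirderiv v (\<lambda>x. \<Sum>i\<in>A. F i x) x = (\<Sum>i\<in>A. dirderiv v (F i) x)"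
  by (rule dirderiv_eqI) (intro has_derivative_sum smooth_has_derivative)

lemma dirderiv_bounded_linear_comp:
  "bounded_linear L \<Longrightarrow> smooth F \<Longrightarrow> dirderiv v (\<lambda>x. L (F x)) x = L (dirderiv v F x)"
  by (rule dirderiv_eqI) (rule bounded_linear.has_derivative[OF _ smooth_has_derivative])

lemma dirderiv_nth: "smooth F \<Longrightarrow> dirderiv v (\<lambda>x. F x $ i) x = dirderiv v F x $ i"
  by (rule dirderiv_bounded_linear_comp) (rule bounded_linear_vec_nth)

lemma dirderiv_divide: "smooth F \<Longrightarrow> dirderiv v (\<lambda>x. F x / c :: real) x = dirderiv v F x / c"
  by (rule dirderiv_bounded_linear_comp[OF bounded_linear_divide])

lemma dirderiv_const: "dirderiv v (\<lambda>_. c) x = 0"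
  by (simp add: dirderiv_def)

lemma dirderiv_affine_comp:
  assumes "bounded_linear L" "smooth F"
  shows "dirderiv v (\<lambda>x. F (a + L x)) x = dirderiv (L v) F (a + L x)"
  by (rule dirderiv_eqI)
    (rule has_derivative_compose[OF _ smooth_has_derivative[OF assms(2)], of "\<lambda>x. a + L x" L],
      auto intro!: derivative_eq_intros bounded_linear_imp_has_derivative assms)

lemma smooth_vector_derivative_comp:
  assumes "smooth F" "(\<gamma> has_vector_derivative v) (at t)"
  shows "((\<lambda>t. F (\<gamma> t)) has_vector_derivative dirderiv v F (\<gamma> t)) (at t)"
proof -
  have "((\<lambda>t. F (\<gamma> t)) has_derivative (\<lambda>s. dirderiv (s *\<^sub>R v) F (\<gamma> t))) (at t)"
    by (rule has_derivative_compose[OF assms(2)[unfolded has_vector_derivative_def]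
          smooth_has_derivative[OF assms(1)]])
  thus ?thesis
    by (simp add: has_vector_derivative_def dirderiv_scaleR_dir smooth_differentiable assms)
qed

lemma smooth_dirderiv_comp_line:
  assumes "smooth F"
  shows "((\<lambda>t. F (x + t *\<^sub>R v)) has_vector_derivative dirderiv v F (x + t *\<^sub>R v)) (at t)"
  by (rule smooth_vector_derivative_comp[OF assms]) (auto intro!: derivative_eq_intros)


text \<open>Clairaut: both mixed derivatives are limits of the second difference
  of \<open>F\<close> over the same small parallelograms.\<close>

lemma second_difference_mvt:
  fixes F :: "'a::euclidean_space \<Rightarrow> real"
  assumes "smooth F" "0 < h"
  shows "\<exists>s t. 0 < s \<and> s < h \<and> 0 < t \<and> t < h \<and>
    F (x + h *\<^sub>R u + h *\<^sub>R v) - F (x + h *\<^sub>R u) - F (x + h *\<^sub>R v) + F x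
      = h * h * dirderiv v (dirderiv u F) (x + s *\<^sub>R u + t *\<^sub>R v)"
proof -
  \<comment> \<open>The second difference is the increment of \<open>G\<close> over [0, h], and
    \<open>G' s\<close> is the increment of \<open>K\<close>; the mean value theorem is applied to
    each.\<close>
  define G where "G s = F ((x + h *\<^sub>R v) + s *\<^sub>R u) - F (x + s *\<^sub>R u)" for s
  define G' where "G' s = dirderiv u F ((x + h *\<^sub>R v) + s *\<^sub>R u) - dirderiv u F (x + s *\<^sub>R u)" for s
  have "DERIV G s :> G' s" for s
    unfolding G_def G'_def has_real_derivative_iff_has_vector_derivative
    by (intro has_vector_derivative_diff smooth_dirderiv_comp_line assms)
  from MVT2[OF assms(2), of G G', OF this]
  obtain s where s: "0 < s" "s < h" "G h - G 0 = h * G' s" by auto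
  define K where "K t = dirderiv u F ((x + s *\<^sub>R u) + t *\<^sub>R v)" for t
  have "DERIV K t :> dirderiv v (dirderiv u F) ((x + s *\<^sub>R u) + t *\<^sub>R v)" for t
    unfolding K_def has_real_derivative_iff_has_vector_derivative
    by (intro smooth_dirderiv_comp_line smooth_dirderiv assms)
  from MVT2[OF assms(2), of K, OF this]
  obtain t where t: "0 < t" "t < h"
    "K h - K 0 = h * dirderiv v (dirderiv u F) ((x + s *\<^sub>R u) + t *\<^sub>R v)" by auto
  have "F (x + h *\<^sub>R u + h *\<^sub>R v) - F (x + h *\<^sub>R u) - F (x + h *\<^sub>R v) + F x = G h - G 0"
    by (simp add: G_def algebra_simps)
  also have "\<dots> = h * (K h - K 0)"
    unfolding s(3) by (simp add: G'_def K_def algebra_simps)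
  finally show ?thesis using s t by auto
qed

lemma mixed_dirderiv_limit:
  fixes F :: "'a::euclidean_space \<Rightarrow> real"
  assumes "smooth F"
  shows "((\<lambda>h. (F (x + h *\<^sub>R u + h *\<^sub>R v) - F (x + h *\<^sub>R u) - F (x + h *\<^sub>R v) + F x) / (h * h))
    \<longlongrightarrow> dirderiv v (dirderiv u F) x) (at_right 0)"
proof (rule tendstoI)
  fix e :: real assume "e > 0"
  let ?K = "dirderiv v (dirderiv u F)"
  have "continuous_on UNIV ?K" by (intro smooth_continuous_on smooth_dirderiv assms)
  then obtain d where d: "d > 0" "\<And>y. dist y x < d \<Longrightarrow> dist (?K y) (?K x) < e"
    using \<open>e > 0\<close> unfolding continuous_on_iff by (metis UNIV_I)
  \<comment> \<open>For h < b the intermediate point stays within d of x; the added 1 keeps the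
    divisor positive when both directions are 0.\<close>
  define b where "b = d / (norm u + norm v + 1)"
  have pos: "norm u + norm v + 1 > 0" by (simp add: add_nonneg_pos)
  have "b > 0" using d pos by (simp add: b_def)
  have "dist ((F (x + h *\<^sub>R u + h *\<^sub>R v) - F (x + h *\<^sub>R u) - F (x + h *\<^sub>R v) + F x) / (h * h)) (?K x) < e"
    if h: "0 < h" "h < b" for h
  proof -
    obtain s t where st: "0 < s" "s < h" "0 < t" "t < h"
      "F (x + h *\<^sub>R u + h *\<^sub>R v) - F (x + h *\<^sub>R u) - F (x + h *\<^sub>R v) + F x
        = h * h * ?K (x + s *\<^sub>R u + t *\<^sub>R v)"
      using second_difference_mvt[OF assms h(1)] by blast
    have "dist (x + s *\<^sub>R u + t *\<^sub>R v) x = norm (s *\<^sub>R u + t *\<^sub>R v)" by (simp add: dist_norm)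
    also have "\<dots> \<le> s * norm u + t * norm v"
      using norm_triangle_ineq[of "s *\<^sub>R u" "t *\<^sub>R v"] st by simp
    also have "\<dots> \<le> h * norm u + h * norm v"
      using st by (intro add_mono mult_right_mono) auto
    also have "\<dots> < h * (norm u + norm v + 1)" using h by (simp add: algebra_simps)
    also have "\<dots> < b * (norm u + norm v + 1)" using h pos by (intro mult_strict_right_mono) auto
    also have "\<dots> = d" using pos by (simp add: b_def)
    finally have "dist (?K (x + s *\<^sub>R u + t *\<^sub>R v)) (?K x) < e" by (rule d(2))
    thus ?thesis unfolding st(5) using h by simp
  qed
  thus "\<forall>\<^sub>F h in at_right 0.
      dist ((F (x + h *\<^sub>R u + h *\<^sub>R v) - F (x + h *\<^sub>R u) - F (x + h *\<^sub>R v) + F x) / (h * h)) (?K x) < e"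
    unfolding eventually_at_right_field using \<open>b > 0\<close> by auto
qed

lemma dirderiv_commute_real:
  fixes F :: "'a::euclidean_space \<Rightarrow> real"
  assumes "smooth F"
  shows "dirderiv u (dirderiv v F) x = dirderiv v (dirderiv u F) x"
proof (rule tendsto_unique[OF _ mixed_dirderiv_limit[OF assms, of x v u]])
  \<comment> \<open>The second difference is symmetric in \<open>u\<close> and \<open>v\<close>, so
    both orders of differentiation are limits of the same quotient.\<close>
  show "((\<lambda>h. (F (x + h *\<^sub>R v + h *\<^sub>R u) - F (x + h *\<^sub>R v) - F (x + h *\<^sub>R u) + F x) / (h * h))
    \<longlongrightarrow> dirderiv v (dirderiv u F) x) (at_right 0)"
    using mixed_dirderiv_limit[OF assms, of x u v] by (simp add: algebra_simps)
qed (rule trivial_limit_at_right_real)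

text \<open>The mean value argument is for real values; inner products with basis vectors carry it
  over to vector values.\<close>

lemma dirderiv_commute:
  fixes F :: "'a::euclidean_space \<Rightarrow> 'b::euclidean_space"
  assumes "smooth F"
  shows "dirderiv u (dirderiv v F) x = dirderiv v (dirderiv u F) x"
proof (rule euclidean_eqI)
  fix b :: 'b
  have s: "smooth (\<lambda>x. F x \<bullet> b)"
    by (rule smooth_bounded_linear_comp[OF bounded_linear_inner_left assms])
  have 1: "dirderiv v (\<lambda>x. F x \<bullet> b) = (\<lambda>x. dirderiv v F x \<bullet> b)" for v
    by (rule ext) (rule dirderiv_bounded_linear_comp[OF bounded_linear_inner_left assms])
  have 2: "dirderiv u (\<lambda>x. dirderiv v F x \<bullet> b) x = dirderiv u (dirderiv v F) x \<bullet> b" for u v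
    by (rule dirderiv_bounded_linear_comp[OF bounded_linear_inner_left smooth_dirderiv[OF assms]])
  show "dirderiv u (dirderiv v F) x \<bullet> b = dirderiv v (dirderiv u F) x \<bullet> b"
    using dirderiv_commute_real[OF s, of u v x] unfolding 1 2 .
qed

lemma dirderiv_dirderiv_field:
  fixes F :: "real^'i::finite \<Rightarrow> 'b::euclidean_space"
  assumes "smooth F" "smooth V"
  shows "dirderiv u (\<lambda>x. dirderiv (V x) F x) x
    = dirderiv u (dirderiv (V x) F) x + dirderiv (dirderiv u V x) F x"
proof -
  have "dirderiv u (\<lambda>x. dirderiv (V x) F x) x
     = (\<Sum>i\<in>UNIV. V x $ i *\<^sub>R dirderiv u (dirderiv (axis i 1) F) x
         + dirderiv u V x $ i *\<^sub>R dirderiv (axis i 1) F x)"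
    by (subst dirderiv_expand[OF smooth_differentiable[OF assms(1)]])
      (simp add: dirderiv_sum dirderiv_scaleR dirderiv_nth smooth_intros assms)
  also have "\<dots> = dirderiv (V x) (dirderiv u F) x + dirderiv (dirderiv u V x) F x"
    unfolding sum.distrib dirderiv_commute[OF assms(1), of u]
      dirderiv_expand[OF smooth_differentiable[OF smooth_dirderiv[OF assms(1)]], symmetric]
      dirderiv_expand[OF smooth_differentiable[OF assms(1)], symmetric] ..
  finally show ?thesis by (simp add: dirderiv_commute[OF assms(1), of u])
qed

subsection \<open>Weighted radial averages\<close>

text \<open>Along the ray through \<open>x\<close>, the weights \<open>1\<close> and
  \<open>1 - s\<close> give the first and second primitive of \<open>G\<close> up to powers of the
  time. In this form they depend smoothly on the end point, which makes the exponential map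
  smooth.\<close>

definition radial_mean :: "(real \<Rightarrow> real) \<Rightarrow> ('a::euclidean_space \<Rightarrow> 'b::euclidean_space) \<Rightarrow> 'a \<Rightarrow> 'b" where
  "radial_mean w G x = integral {0..1} (\<lambda>s. w s *\<^sub>R G (s *\<^sub>R x))"

lemma continuous_on_radial:
  fixes G :: "'a::real_normed_vector \<Rightarrow> 'b::real_normed_vector"
  assumes "continuous_on {0..1} w" "continuous_on UNIV G"
  shows "continuous_on {0..1} (\<lambda>s. w s *\<^sub>R G (s *\<^sub>R x))"
proof -
  have "continuous_on {0..1} (\<lambda>s. G (s *\<^sub>R x))"
    by (rule continuous_on_compose2[OF assms(2)]) (auto intro!: continuous_intros)
  thus ?thesis using assms(1) by (intro continuous_on_scaleR)
qed

text \<open>Differentiation under the integral sign. The inner factor \<open>s\<close> moves into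
  the weight, so radial means with arbitrary continuous weights are closed under
  differentiation.\<close>

lemma radial_mean_has_derivative:
  fixes G :: "'a::euclidean_space \<Rightarrow> 'b::euclidean_space"
  assumes w: "continuous_on {0..1} w" and G: "Ck (Suc k) G"
  shows "(radial_mean w G has_derivative (\<lambda>v. radial_mean (\<lambda>s. w s * s) (dirderiv v G) x)) (at x)"
proof -
  \<comment> \<open>The Leibniz rule wants the derivative as a bounded linear map that is jointly
    continuous in \<open>x\<close> and \<open>s\<close>; in finite dimension continuity is tested on
    basis vectors.\<close>
  define fx where "fx x s = Blinfun (\<lambda>v. (w s * s) *\<^sub>R dirderiv v G (s *\<^sub>R x))" for x s
  have Ck0: "continuous_on UNIV (dirderiv v G)" for v
    using Ck_SucD(3)[OF G, of v] by (induction k) (auto dest: Ck_decr)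
  have contG: "continuous_on UNIV G"
    using Ck_SucD(1)[OF G] by (simp add: continuous_at_imp_continuous_on differentiable_imp_continuous_within)
  have bl: "bounded_linear (\<lambda>v. (w s * s) *\<^sub>R dirderiv v G (s *\<^sub>R x))" for s x
    by (rule bounded_linear_compose[OF bounded_linear_scaleR_right has_derivative_bounded_linear[OF Ck_SucD(2)[OF G]]])
  have fx: "fx x s v = (w s * s) *\<^sub>R dirderiv v G (s *\<^sub>R x)" for x s v
    by (simp add: fx_def bounded_linear_Blinfun_apply[OF bl])
  have cont: "continuous_on (UNIV \<times> cbox 0 1) (\<lambda>(x, s). fx x s)"
    unfolding case_prod_beta
  proof (rule continuous_on_blinfun_componentwise)
    fix i :: 'a
    show "continuous_on (UNIV \<times> cbox 0 1) (\<lambda>z. fx (fst z) (snd z) i)"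
      unfolding fx
      by (intro continuous_intros continuous_on_compose2[OF w] continuous_on_compose2[OF Ck0]) auto
  qed
  have "((\<lambda>x. integral (cbox 0 1) (\<lambda>s. w s *\<^sub>R G (s *\<^sub>R x))) has_derivative integral (cbox 0 1) (fx x)) (at x within UNIV)"
  proof (rule leibniz_rule[OF _ _ cont])
    fix x :: 'a and s :: real
    have "((\<lambda>x. w s *\<^sub>R G (s *\<^sub>R x)) has_derivative (\<lambda>v. w s *\<^sub>R dirderiv (s *\<^sub>R v) G (s *\<^sub>R x))) (at x)"
      by (intro has_derivative_scaleR_right has_derivative_compose[OF _ Ck_SucD(2)[OF G], of "\<lambda>x. s *\<^sub>R x" "\<lambda>v. s *\<^sub>R v"] has_derivative_ident)
    thus "((\<lambda>x. w s *\<^sub>R G (s *\<^sub>R x)) has_derivative blinfun_apply (fx x s)) (at x within UNIV)"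
      by (simp add: fx[abs_def] dirderiv_scaleR_dir[OF Ck_SucD(1)[OF G]])
    show "(\<lambda>s. w s *\<^sub>R G (s *\<^sub>R x)) integrable_on cbox 0 1"
      using integrable_continuous_real[OF continuous_on_radial[OF w contG]] by simp
  qed auto
  moreover have "blinfun_apply (integral (cbox 0 1) (fx x)) = (\<lambda>v. radial_mean (\<lambda>s. w s * s) (dirderiv v G) x)"
  proof
    fix v
    have "continuous_on (cbox 0 1) (fx x)"
      using continuous_on_compose2[OF cont, of "cbox 0 1" "\<lambda>s. (x, s)"] by (force intro: continuous_intros)
    thus "blinfun_apply (integral (cbox 0 1) (fx x)) v = radial_mean (\<lambda>s. w s * s) (dirderiv v G) x"
      by (subst blinfun_apply_integral) (auto simp: fx radial_mean_def intro: integrable_continuous_real)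
  qed
  moreover have "radial_mean w G = (\<lambda>x. integral (cbox 0 1) (\<lambda>s. w s *\<^sub>R G (s *\<^sub>R x)))"
    by (rule ext) (simp only: radial_mean_def box_real)
  ultimately show ?thesis by (simp only:)
qed

lemma Ck_radial_mean:
  assumes "continuous_on {0..1} w" "Ck k G"
  shows "Ck k (radial_mean w G)"
  using assms
proof (induction k arbitrary: w G)
  case 0
  have w: "continuous_on (UNIV \<times> cbox 0 1) (\<lambda>z. w (snd z))"
    by (rule continuous_on_compose2[OF 0(1)]) (auto intro!: continuous_on_snd continuous_on_id)
  have "continuous_on (UNIV \<times> cbox 0 1) (\<lambda>z. G (snd z *\<^sub>R fst z))"
  proof (rule continuous_on_compose2[of UNIV G])
    show "continuous_on UNIV G" using 0(2) by simp
    show "continuous_on (UNIV \<times> cbox 0 1) (\<lambda>z::'a \<times> real. snd z *\<^sub>R fst z)"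
      by (intro continuous_intros)
  qed simp
  hence "continuous_on (UNIV \<times> cbox 0 1) (\<lambda>(x, s). w s *\<^sub>R G (s *\<^sub>R x))"
    unfolding case_prod_beta by (rule continuous_on_scaleR[OF w])
  hence "continuous_on UNIV (\<lambda>x. integral (cbox 0 1) (\<lambda>s. w s *\<^sub>R G (s *\<^sub>R x)))"
    by (rule integral_continuous_on_param)
  thus ?case unfolding Ck.simps(1) box_real radial_mean_def .
next
  case (Suc k)
  have ws: "continuous_on {0..1} (\<lambda>s. w s * s)"
    by (intro continuous_on_mult continuous_on_id Suc.prems)
  show ?case
    by (rule Ck_SucI[OF radial_mean_has_derivative[OF Suc.prems]])
      (rule Suc.IH[OF ws Ck_SucD(3)[OF Suc.prems(2)]])
qed

lemma smooth_radial_mean: "continuous_on {0..1} w \<Longrightarrow> smooth G \<Longrightarrow> smooth (radial_mean w G)"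
  by (simp add: smooth_def Ck_radial_mean)

lemma dirderiv_radial_mean:
  assumes "continuous_on {0..1} w" "smooth G"
  shows "dirderiv v (radial_mean w G) x = radial_mean (\<lambda>s. w s * s) (dirderiv v G) x"
  using assms radial_mean_has_derivative[of w 0 G] by (intro dirderiv_eqI) (auto simp: smooth_def)

lemma has_integral_radial_mean:
  assumes "continuous_on {0..1} w" "smooth G"
  shows "((\<lambda>s. w s *\<^sub>R G (s *\<^sub>R x)) has_integral radial_mean w G x) {0..1}"
  unfolding radial_mean_def
  by (intro integrable_integral integrable_continuous_real continuous_on_radial smooth_continuous_on assms)

lemma radial_mean_at_0:
  assumes "continuous_on {0..1} w" "smooth G"
  shows "radial_mean w G 0 = integral {0..1} w *\<^sub>R G 0"
proof -
  have "((\<lambda>s. w s *\<^sub>R G 0) has_integral integral {0..1} w *\<^sub>R G 0) {0..1}"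
    by (intro has_integral_scaleR_left integrable_integral integrable_continuous_real assms)
  thus ?thesis using has_integral_radial_mean[OF assms, of 0] by (simp add: has_integral_unique)
qed

lemma smooth_radial_line:
  assumes "smooth G"
  shows "((\<lambda>s. G (s *\<^sub>R x)) has_vector_derivative dirderiv x G (s *\<^sub>R x)) (at s)"
  using smooth_dirderiv_comp_line[OF assms, of 0 x s] by simp

text \<open>Integration by parts expresses the first and second primitives of \<open>t \<mapsto> G (t x)\<close>
  that vanish at \<open>0\<close>.\<close>

lemma radial_mean_parts:
  assumes "smooth G"
  shows "dirderiv y (radial_mean (\<lambda>_. 1) G) y + radial_mean (\<lambda>_. 1) G y = G y"
proof -
  have "((\<lambda>s. (1 * s) *\<^sub>R dirderiv y G (s *\<^sub>R y) + 1 *\<^sub>R G (s *\<^sub>R y)) has_integral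
      radial_mean (\<lambda>s. 1 * s) (dirderiv y G) y + radial_mean (\<lambda>_. 1) G y) {0..1}"
    by (intro has_integral_add has_integral_radial_mean smooth_dirderiv assms continuous_intros)
  moreover have "((\<lambda>s. s *\<^sub>R dirderiv y G (s *\<^sub>R y) + 1 *\<^sub>R G (s *\<^sub>R y)) has_integral
      (1 *\<^sub>R G (1 *\<^sub>R y) - 0 *\<^sub>R G (0 *\<^sub>R y))) {0..1}"
    by (intro fundamental_theorem_of_calculus has_vector_derivative_scaleR
        has_vector_derivative_at_within[OF smooth_radial_line] assms)
      (auto intro!: derivative_eq_intros)
  ultimately show ?thesis
    by (simp add: dirderiv_radial_mean assms has_integral_unique)
qed

lemma radial_mean_parts_twice:
  assumes "smooth G"
  shows "dirderiv y (radial_mean (\<lambda>s. 1 - s) G) y + 2 *\<^sub>R radial_mean (\<lambda>s. 1 - s) G y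
    = radial_mean (\<lambda>_. 1) G y"
proof -
  let ?I = "radial_mean (\<lambda>s. (1 - s) * s) (dirderiv y G) y + 2 *\<^sub>R radial_mean (\<lambda>s. 1 - s) G y
    - radial_mean (\<lambda>_. 1) G y"
  have "((\<lambda>s. ((1 - s) * s) *\<^sub>R dirderiv y G (s *\<^sub>R y) + 2 *\<^sub>R ((1 - s) *\<^sub>R G (s *\<^sub>R y))
      - 1 *\<^sub>R G (s *\<^sub>R y)) has_integral ?I) {0..1}"
    by (intro has_integral_add has_integral_diff has_integral_cmul has_integral_radial_mean
        smooth_dirderiv assms continuous_intros)
  moreover have "(\<lambda>s. ((1 - s) * s) *\<^sub>R dirderiv y G (s *\<^sub>R y) + 2 *\<^sub>R ((1 - s) *\<^sub>R G (s *\<^sub>R y))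
      - 1 *\<^sub>R G (s *\<^sub>R y)) = (\<lambda>s. ((1 - s) * s) *\<^sub>R dirderiv y G (s *\<^sub>R y) + (1 - 2 * s) *\<^sub>R G (s *\<^sub>R y))"
    by (auto simp: algebra_simps scaleR_2)
  \<comment> \<open>The integrand is the derivative of \<open>s (1 - s) G (s y)\<close>, which
    vanishes at both ends of the interval.\<close>
  moreover have "((\<lambda>s. ((1 - s) * s) *\<^sub>R dirderiv y G (s *\<^sub>R y) + (1 - 2 * s) *\<^sub>R G (s *\<^sub>R y)) has_integral
      (((1 - 1) * 1) *\<^sub>R G (1 *\<^sub>R y) - ((1 - 0) * 0) *\<^sub>R G (0 *\<^sub>R y))) {0..1}"
    by (intro fundamental_theorem_of_calculus has_vector_derivative_scaleR
        has_vector_derivative_at_within[OF smooth_radial_line] assms)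
      (auto intro!: derivative_eq_intros)
  ultimately have "?I = ((1 - 1) * 1) *\<^sub>R G (1 *\<^sub>R y) - ((1 - 0) * 0) *\<^sub>R G (0 *\<^sub>R y)"
    using has_integral_unique by (simp only:)
  hence "?I = 0" by simp
  thus ?thesis
    by (simp add: dirderiv_radial_mean[OF continuous_on_diff[OF continuous_on_const continuous_on_id]] assms)
qed

text \<open>The product rule leaves a derivative of the mean along \<open>x\<close>; multiplied by
  \<open>t\<close> it is the radial derivative at \<open>t x\<close>, to which
  \<open>radial_mean_parts\<close> applies. This treats all real \<open>t\<close> at once, including
  0 and negative times.\<close>

lemma radial_primitive:
  fixes G :: "'a::euclidean_space \<Rightarrow> 'b::euclidean_space"
  assumes "smooth G"
  shows "((\<lambda>t. t *\<^sub>R radial_mean (\<lambda>_. 1) G (t *\<^sub>R x)) has_vector_derivative G (t *\<^sub>R x)) (at t)"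
proof -
  let ?M = "radial_mean (\<lambda>_. 1) G"
  have sm: "smooth ?M" by (intro smooth_radial_mean assms continuous_intros)
  have "((\<lambda>t. t *\<^sub>R ?M (t *\<^sub>R x)) has_vector_derivative
      t *\<^sub>R dirderiv x ?M (t *\<^sub>R x) + 1 *\<^sub>R ?M (t *\<^sub>R x)) (at t)"
    by (intro has_vector_derivative_scaleR smooth_radial_line sm) (auto intro: derivative_eq_intros)
  moreover have "t *\<^sub>R dirderiv x ?M (t *\<^sub>R x) = dirderiv (t *\<^sub>R x) ?M (t *\<^sub>R x)"
    by (rule dirderiv_scaleR_dir[symmetric]) (rule smooth_differentiable[OF sm])
  ultimately show ?thesis by (simp only: scaleR_one radial_mean_parts[OF assms])
qed

lemma radial_second_primitive:
  fixes G :: "'a::euclidean_space \<Rightarrow> 'b::euclidean_space"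
  assumes "smooth G"
  shows "((\<lambda>t. t\<^sup>2 *\<^sub>R radial_mean (\<lambda>s. 1 - s) G (t *\<^sub>R x)) has_vector_derivative
    t *\<^sub>R radial_mean (\<lambda>_. 1) G (t *\<^sub>R x)) (at t)"
proof -
  let ?M = "radial_mean (\<lambda>s. 1 - s) G"
  have sm: "smooth ?M" by (intro smooth_radial_mean assms continuous_intros)
  have "((\<lambda>t. t\<^sup>2 *\<^sub>R ?M (t *\<^sub>R x)) has_vector_derivative
      t\<^sup>2 *\<^sub>R dirderiv x ?M (t *\<^sub>R x) + (2 * t) *\<^sub>R ?M (t *\<^sub>R x)) (at t)"
    by (intro has_vector_derivative_scaleR smooth_radial_line sm) (auto intro!: derivative_eq_intros)
  moreover have "t\<^sup>2 *\<^sub>R dirderiv x ?M (t *\<^sub>R x) + (2 * t) *\<^sub>R ?M (t *\<^sub>R x)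
      = t *\<^sub>R (dirderiv (t *\<^sub>R x) ?M (t *\<^sub>R x) + 2 *\<^sub>R ?M (t *\<^sub>R x))"
    by (simp add: dirderiv_scaleR_dir[OF smooth_differentiable[OF sm]] power2_eq_square scaleR_add_right mult.commute)
  ultimately show ?thesis by (simp only: radial_mean_parts_twice[OF assms])
qed

section \<open>The metric and its connection\<close>

definition base :: "'n coord set" where
  "base = range cZ \<union> range cT"

text \<open>The index duality of the metric: apart from the entry at \<open>cX\<close>,
  \<open>cX\<close>, the metric matrix is the permutation matrix of \<open>star\<close>.\<close>

fun star :: "'n coord \<Rightarrow> 'n coord" where
  "star cX = cXs"
| "star cXs = cX"
| "star (cZ i) = cZs i"
| "star (cZs i) = cZ i"
| "star (cT i) = cTs i"
| "star (cTs i) = cT i"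

lemma star_star [simp]: "star (star c) = c"
  by (cases c) auto

lemma star_eq_iff [simp]: "star c = cXs \<longleftrightarrow> c = cX" "star c = cX \<longleftrightarrow> c = cXs"
  by (cases c; simp)+

lemma star_unstarred [simp]: "star c \<in> insert cX base \<longleftrightarrow> c \<notin> insert cX base"
  by (cases c) (auto simp: base_def)

lemma cX_notin_base [simp]: "cX \<notin> base" "cXs \<notin> base"
  by (auto simp: base_def)

lemma gM_comp_eq:
  "gM_comp f P a b = (if a = cX \<and> b = cX then gM_xx f P else 0) + (if b = star a then 1 else 0)"
  by (cases a; cases b) auto

text \<open>The flat neutral form that remains of \<open>gM f\<close> when the entry
  \<open>gM_xx f\<close> is removed, see \<open>ginner_gM\<close>.\<close>

definition star_pairing :: "real^('n::finite coord) \<Rightarrow> real^('n coord) \<Rightarrow> real" where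
  "star_pairing u v = (\<Sum>c\<in>UNIV. u $ c * v $ star c)"

lemma star_pairing_simps:
  "star_pairing (u + u') v = star_pairing u v + star_pairing u' v"
  "star_pairing u (v + v') = star_pairing u v + star_pairing u v'"
  "star_pairing (u - u') v = star_pairing u v - star_pairing u' v"
  "star_pairing u (v - v') = star_pairing u v - star_pairing u v'"
  "star_pairing (- u) v = - star_pairing u v"
  "star_pairing u (- v) = - star_pairing u v"
  "star_pairing (r *\<^sub>R u) v = r * star_pairing u v"
  "star_pairing u (r *\<^sub>R v) = r * star_pairing u v"
  by (simp_all add: star_pairing_def algebra_simps sum.distrib sum_subtractf sum_distrib_left sum_negf)

lemma star_pairing_commute: "star_pairing u v = star_pairing v u"
  unfolding star_pairing_def
  by (rule sum.reindex_bij_witness[of _ star star]) auto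

lemma star_pairing_axis: "star_pairing u (axis c 1) = u $ star c"
proof -
  have "star_pairing u (axis c 1) = (\<Sum>d\<in>UNIV. if star c = d then u $ d else 0)"
    unfolding star_pairing_def axis_def by (intro sum.cong) auto
  thus ?thesis by simp
qed

definition unstarred_part :: "real^('n::finite coord) \<Rightarrow> real^('n coord)" where
  "unstarred_part v = (\<chi> c. if c \<in> insert cX base then v $ c else 0)"

lemma unstarred_part_eq_iff:
  "unstarred_part u = unstarred_part v \<longleftrightarrow> (\<forall>c\<in>insert cX base. u $ c = v $ c)"
  unfolding unstarred_part_def vec_eq_iff by auto

lemma unstarred_part_eq_0_iff: "unstarred_part u = 0 \<longleftrightarrow> (\<forall>c\<in>insert cX base. u $ c = 0)"
  unfolding unstarred_part_def vec_eq_iff by auto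

lemma unstarred_part_simps:
  "unstarred_part (u + v) = unstarred_part u + unstarred_part v"
  "unstarred_part (u - v) = unstarred_part u - unstarred_part v"
  "unstarred_part (- u) = - unstarred_part u"
  "unstarred_part (r *\<^sub>R u) = r *\<^sub>R unstarred_part u"
  "unstarred_part 0 = 0"
  by (auto simp: unstarred_part_def vec_eq_iff)

lemma unstarred_part_nth [simp]:
  "unstarred_part v $ cX = v $ cX" "c \<in> base \<Longrightarrow> unstarred_part v $ c = v $ c"
  by (auto simp: unstarred_part_def)

lemma unstarred_part_idem [simp]: "unstarred_part (unstarred_part v) = unstarred_part v"
  by (auto simp: unstarred_part_def vec_eq_iff)

text \<open>Each product pairs an index with its dual, and one of the two is unstarred. So the
  starred directions span a totally isotropic subspace.\<close>

lemma star_pairing_starred: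
  assumes "unstarred_part u = 0" "unstarred_part v = 0"
  shows "star_pairing u v = 0"
  unfolding star_pairing_def
  using assms by (intro sum.neutral) (metis mult_eq_0_iff star_unstarred unstarred_part_eq_0_iff)

lemma star_pairing_unstarred:
  assumes "unstarred_part u = 0"
  shows "star_pairing u v = star_pairing u (unstarred_part v)"
proof -
  have "unstarred_part (v - unstarred_part v) = 0"
    by (simp add: unstarred_part_simps)
  from star_pairing_starred[OF assms this] show ?thesis by (simp add: star_pairing_simps)
qed

lemma ginner_gM: "ginner (gM f) P u v = gM_xx f P * u $ cX * v $ cX + star_pairing u v"
proof -
  have "(gM f P *v v) $ a = (if a = cX then gM_xx f P * v $ cX else 0) + v $ star a" for a
  proof -
    have "(gM f P *v v) $ a = (\<Sum>b\<in>UNIV. (if cX = b then (if a = cX then gM_xx f P * v $ b else 0) else 0)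
        + (if star a = b then v $ b else 0))"
      unfolding matrix_vector_mult_def gM_def by (auto simp: gM_comp_eq intro!: sum.cong)
    thus ?thesis by (simp add: sum.distrib)
  qed
  hence "ginner (gM f) P u v = (\<Sum>a\<in>UNIV. (if cX = a then u $ a * (gM_xx f P * v $ cX) else 0) + u $ a * v $ star a)"
    unfolding ginner_def inner_vec_def by (auto simp: algebra_simps intro!: sum.cong)
  thus ?thesis by (simp add: sum.distrib star_pairing_def)
qed

text \<open>Vector identities below are obtained by pairing both sides with an arbitrary vector; for
  the connection this is where Koszul's formula applies.\<close>

lemma ginner_nondegenerate:
  assumes "invertible (g P)" "\<And>w. ginner g P w a = ginner g P w b"
  shows "a = b"
proof -
  have "w \<bullet> (g P *v (a - b)) = 0" for w
    using assms(2)[of w] by (simp add: ginner_def matrix_vector_mult_diff_distrib inner_diff_right)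
  hence "g P *v (a - b) = 0" by (metis inner_eq_zero_iff)
  moreover obtain B where "B ** g P = mat 1" using assms(1) unfolding invertible_def by blast
  hence "B *v (g P *v x) = x" for x by (simp add: matrix_vector_mul_assoc)
  ultimately show ?thesis by (metis eq_iff_diff_eq_0 matrix_vector_mult_0_right)
qed

lemma matrix_inv_gM:
  "matrix_inv (gM f P) $ a $ b
    = (if b = star a then 1 else 0) - (if a = cXs \<and> b = cXs then gM_xx f P else 0)"
proof -
  \<comment> \<open>The \<open>cX\<close>, \<open>cXs\<close> block of the metric has rows (H, 1)
    and (1, 0), its inverse has rows (0, 1) and (1, -H). The other entries form a permutation matrix
    that is its own inverse.\<close>
  define M :: "real^('a coord)^('a coord)" where
    "M = (\<chi> a b. (if b = star a then 1 else 0) - (if a = cXs \<and> b = cXs then gM_xx f P else 0))"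
  have "gM f P *v (M *v v) = v" for v
  \<comment> \<open>With the identity matrix as metric, this is equality of vectors tested by the
    Euclidean inner product.\<close>
  proof (rule ginner_nondegenerate[of "\<lambda>_. mat 1" P])
    fix w
    have M: "(M *v v) $ a = v $ star a - (if a = cXs then gM_xx f P * v $ cXs else 0)" for a
    proof -
      have "(M *v v) $ a = (\<Sum>b\<in>UNIV. (if star a = b then v $ b else 0)
          - (if cXs = b then (if a = cXs then gM_xx f P * v $ b else 0) else 0))"
        unfolding matrix_vector_mult_def M_def by (auto intro!: sum.cong simp: algebra_simps)
      thus ?thesis by (simp add: sum_subtractf)
    qed
    have "star_pairing w (M *v v) = (\<Sum>c\<in>UNIV. w $ c * v $ c - (if cX = c then gM_xx f P * w $ c * v $ cXs else 0))"
      unfolding star_pairing_def M by (intro sum.cong) (auto simp: algebra_simps)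
    also have "\<dots> = w \<bullet> v - gM_xx f P * w $ cX * v $ cXs"
      by (simp add: sum_subtractf inner_vec_def)
    finally show "ginner (\<lambda>_. mat 1) P w (gM f P *v (M *v v)) = ginner (\<lambda>_. mat 1) P w v"
      using ginner_gM[of f P w "M *v v"] by (simp add: ginner_def M)
  qed (simp add: invertible_def exI[of _ "mat 1"])
  hence "gM f P ** M = mat 1"
    by (metis matrix_eq matrix_vector_mul_assoc matrix_vector_mul_lid)
  hence "matrix_inv (gM f P) = M"
    using matrix_mult_matrix_inv[OF gM_invertible, of f P]
      matrix_mul_assoc[of M "gM f P" "matrix_inv (gM f P)"]
    by (simp add: matrix_left_right_inverse[of _ M])
  thus ?thesis by (simp add: M_def)
qed

section \<open>Functions of the base coordinates\<close>

definition base_only :: "(real^('n::finite coord) \<Rightarrow> 'b) \<Rightarrow> bool" where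
  "base_only G \<longleftrightarrow> (\<forall>P Q. (\<forall>c\<in>base. P $ c = Q $ c) \<longrightarrow> G P = G Q)"

lemma base_onlyD: "base_only G \<Longrightarrow> (\<And>c. c \<in> base \<Longrightarrow> P $ c = Q $ c) \<Longrightarrow> G P = G Q"
  unfolding base_only_def by blast

lemma base_only_shift:
  "base_only G \<Longrightarrow> unstarred_part u = unstarred_part v \<Longrightarrow> G (P + u) = G (P + v)"
  by (rule base_onlyD) (auto simp: unstarred_part_eq_iff)

text \<open>\<open>G\<close> is invariant under the translation by \<open>Q - P\<close>, whose base
  coordinates vanish; hence so is its derivative.\<close>

lemma base_only_dirderiv:
  assumes "base_only G" "smooth G"
  shows "base_only (dirderiv v G)"
  unfolding base_only_def
proof (intro allI impI)
  fix P Q :: "real^('a coord)" assume PQ: "\<forall>c\<in>base. P $ c = Q $ c"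
  have "G = (\<lambda>x. G ((Q - P) + x))"
    by (rule ext, rule base_onlyD[OF assms(1)]) (use PQ in auto)
  hence "dirderiv v G P = dirderiv v (\<lambda>x. G ((Q - P) + x)) P"
    by (rule arg_cong)
  also have "\<dots> = dirderiv v G Q"
    by (subst dirderiv_affine_comp[OF bounded_linear_ident assms(2)]) simp
  finally show "dirderiv v G P = dirderiv v G Q" .
qed

lemma base_only_dirderiv_0:
  fixes G :: "real^('n::finite coord) \<Rightarrow> 'b::euclidean_space"
  assumes "base_only G" "smooth G" "\<And>c. c \<in> base \<Longrightarrow> v $ c = 0"
  shows "dirderiv v G P = 0"
proof -
  have "(\<lambda>t. G (P + t *\<^sub>R v)) = (\<lambda>t. G P)"
    by (rule ext, rule base_onlyD[OF assms(1)]) (use assms(3) in auto)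
  with smooth_dirderiv_comp_line[OF assms(2), of P v 0]
  have "((\<lambda>t. G P) has_vector_derivative dirderiv v G P) (at 0)" by simp
  from vector_derivative_unique_at[OF this has_vector_derivative_const] show ?thesis .
qed

lemma base_only_dirderiv_cong:
  fixes G :: "real^('n::finite coord) \<Rightarrow> 'b::euclidean_space"
  assumes "base_only G" "smooth G" "\<And>c. c \<in> base \<Longrightarrow> u $ c = v $ c"
  shows "dirderiv u G P = dirderiv v G P"
  using base_only_dirderiv_0[OF assms(1,2), of "u - v" P] assms(3)
  by (simp add: dirderiv_diff_dir smooth_differentiable[OF assms(2)])

lemma base_only_gM_xx: "base_only (gM_xx f)"
  unfolding base_only_def gM_xx_def base_def by (auto intro!: arg_cong[of _ _ f] sum.cong)

lemma smooth_gM_xx: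
  assumes "smooth f"
  shows "smooth (gM_xx f)"
proof -
  have bl: "bounded_linear (\<lambda>P::real^('a coord). \<chi> i. P $ cZ i)"
    unfolding linear_conv_bounded_linear[symmetric] by (rule linearI) (auto simp: vec_eq_iff)
  have "smooth (\<lambda>P::real^('a coord). f (\<chi> i. P $ cZ i))"
    using smooth_affine_comp[OF bl assms, of 0] by simp
  thus ?thesis unfolding gM_xx_def by (intro smooth_intros)
qed

section \<open>The Levi-Civita connection in closed form\<close>

locale smooth_gM =
  fixes f :: "real^'n::finite \<Rightarrow> real"
  assumes smooth_f: "smooth f"
begin

abbreviation H where "H \<equiv> gM_xx f"

lemma smooth_H: "smooth H"
  by (rule smooth_gM_xx[OF smooth_f])

lemmas diff_H = smooth_differentiable[OF smooth_H]

text \<open>The gradient of \<open>H\<close> for the flat form, see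
  \<open>star_pairing_grad_star\<close>; it is starred because \<open>H\<close> depends on base
  coordinates only.\<close>

definition grad_star :: "real^('n coord) \<Rightarrow> real^('n coord)" where
  "grad_star P = (\<chi> c. dirderiv (axis (star c) 1) H P)"

text \<open>Koszul's formula with \<open>H\<close> as the only non-constant metric component, solved
  for the connection term.\<close>

definition Gam :: "real^('n coord) \<Rightarrow> real^('n coord) \<Rightarrow> real^('n coord) \<Rightarrow> real^('n coord)" where
  "Gam P u v = (1/2) *\<^sub>R ((u $ cX * dirderiv v H P + v $ cX * dirderiv u H P) *\<^sub>R axis cXs 1
     - (u $ cX * v $ cX) *\<^sub>R grad_star P)"

lemma unstarred_part_grad_star: "unstarred_part (grad_star P) = 0"
  unfolding unstarred_part_eq_0_iff
proof
  fix c :: "'n coord" assume "c \<in> insert cX base"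
  hence "star c \<notin> base" using star_unstarred[of c] by blast
  thus "grad_star P $ c = 0"
    unfolding grad_star_def vec_lambda_beta
    by (intro base_only_dirderiv_0[OF base_only_gM_xx smooth_H]) (auto simp: axis_def)
qed

lemma unstarred_part_axis_cXs: "unstarred_part (axis cXs 1) = 0"
  by (auto simp: unstarred_part_eq_0_iff axis_def)

lemma unstarred_part_Gam: "unstarred_part (Gam P u v) = 0"
  by (simp add: Gam_def unstarred_part_simps unstarred_part_grad_star unstarred_part_axis_cXs)

lemma star_pairing_grad_star: "star_pairing u (grad_star P) = dirderiv u H P"
  unfolding star_pairing_def grad_star_def
  by (subst dirderiv_expand[OF diff_H]) simp

lemma star_pairing_Gam:
  "star_pairing w (Gam P u v) = (1/2) * (u $ cX * w $ cX * dirderiv v H P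
    + v $ cX * w $ cX * dirderiv u H P - u $ cX * v $ cX * dirderiv w H P)"
  by (simp add: Gam_def star_pairing_simps star_pairing_grad_star star_pairing_axis algebra_simps)

text \<open>Pairing with an arbitrary \<open>w\<close> brings in \<open>ginner_christoffel\<close>,
  whose triple sum factors because only the entry at \<open>cX\<close>, \<open>cX\<close> has
  non-zero derivatives.\<close>

lemma christoffel_vec_gM: "christoffel_vec (gM f) P u v = Gam P u v"
proof (rule ginner_nondegenerate[OF gM_invertible])
  fix w :: "real^('n coord)"
  define d :: "'n coord \<Rightarrow> real" where "d c = (if c = cX then 1 else 0)" for c
  define h where "h i = dirderiv (axis i 1) H P" for i
  have p: "partial i (\<lambda>Q. gM f Q $ j $ l) P = h i * d j * d l" for i j l
  proof -
    have "(\<lambda>Q. gM f Q $ j $ l) = (\<lambda>Q. d j * d l * H Q + (if l = star j then 1 else 0))"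
      by (auto simp: gM_def gM_comp_eq d_def)
    thus ?thesis
      unfolding partial_def dirderiv_def[symmetric] h_def
      by (simp add: dirderiv_add dirderiv_mult dirderiv_const smooth_intros smooth_H)
  qed
  have sd: "(\<Sum>l\<in>UNIV. x $ l * d l) = x $ cX" for x
    unfolding d_def by (simp add: if_distrib cong: if_cong)
  have sh: "(\<Sum>l\<in>UNIV. x $ l * h l) = dirderiv x H P" for x
    unfolding h_def by (subst dirderiv_expand[OF diff_H]) simp
  have "ginner (gM f) P w (christoffel_vec (gM f) P u v) = (\<Sum>l\<in>UNIV. \<Sum>i\<in>UNIV. \<Sum>j\<in>UNIV.
      (1/2) * ((w $ l * d l) * (u $ i * h i) * (v $ j * d j) + (w $ l * d l) * (u $ i * d i) * (v $ j * h j)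
      - (w $ l * h l) * (u $ i * d i) * (v $ j * d j)))"
    unfolding ginner_christoffel[of "gM f" P w u v, OF gM_invertible] p
    by (intro sum.cong refl) (simp add: algebra_simps)
  also have "\<dots> = (1/2) * (w $ cX * dirderiv u H P * v $ cX + w $ cX * u $ cX * dirderiv v H P
      - dirderiv w H P * u $ cX * v $ cX)"
    unfolding sum_distrib_left[symmetric] sum_distrib_right[symmetric] sum.distrib sum_subtractf sd sh ..
  \<comment> \<open>\<open>Gam\<close> is starred-valued, so \<open>H\<close> itself drops out of
    the metric pairing.\<close>
  also have "\<dots> = ginner (gM f) P w (Gam P u v)"
    using unstarred_part_Gam[of P u v]
    by (simp add: ginner_gM star_pairing_Gam unstarred_part_eq_0_iff algebra_simps)
  finally show "ginner (gM f) P w (christoffel_vec (gM f) P u v) = ginner (gM f) P w (Gam P u v)" .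
qed

lemma smooth_grad_star: "smooth grad_star"
  by (rule smooth_vec) (simp add: grad_star_def smooth_intros smooth_H)

lemma base_only_grad_star: "base_only grad_star"
  unfolding base_only_def grad_star_def vec_eq_iff vec_lambda_beta
  by (intro allI impI base_onlyD[OF base_only_dirderiv[OF base_only_gM_xx smooth_H]]) blast

text \<open>Decouples the geodesic equation: the acceleration is determined by the unstarred
  coordinates and velocities, and these are never accelerated themselves.\<close>

lemma Gam_cong:
  assumes "\<And>c. c \<in> base \<Longrightarrow> P $ c = Q $ c"
    and "unstarred_part u = unstarred_part u'" and "unstarred_part v = unstarred_part v'"
  shows "Gam P u v = Gam Q u' v'"
proof -
  have "dirderiv u H P = dirderiv u' H Q" if "unstarred_part u = unstarred_part u'" for u u'
    using base_only_dirderiv_cong[OF base_only_gM_xx smooth_H, of u u' P]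
      base_onlyD[OF base_only_dirderiv[OF base_only_gM_xx smooth_H], of P Q u'] assms(1) that
    unfolding unstarred_part_eq_iff by auto
  from this[OF assms(2)] this[OF assms(3)] show ?thesis
    unfolding Gam_def using base_onlyD[OF base_only_grad_star, of P Q] assms by (simp add: unstarred_part_eq_iff)
qed

end

section \<open>Geodesics and the exponential map\<close>

lemma diffeomorphismI:
  assumes "smooth F" "smooth G" "\<And>x. G (F x) = x" "\<And>y. F (G y) = y"
  shows "diffeomorphism F"
proof -
  have "bij F" by (rule o_bij[of G]) (auto simp: fun_eq_iff assms)
  moreover have "inv F = G" by (rule inv_equality) (rule assms(3), rule assms(4))
  ultimately show ?thesis using assms by (simp add: diffeomorphism_def)
qed

lemma radial_mean_nth:
  assumes "continuous_on {0..1} w" "smooth G"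
  shows "radial_mean w G x $ i = radial_mean w (\<lambda>x. G x $ i) x"
proof (rule has_integral_unique)
  show "((\<lambda>s. w s *\<^sub>R (G (s *\<^sub>R x) $ i)) has_integral radial_mean w G x $ i) {0..1}"
    using has_integral_linear[OF has_integral_radial_mean[OF assms, of x] bounded_linear_vec_nth, of i]
    by (simp add: o_def)
qed (rule has_integral_radial_mean[OF assms(1) smooth_nth[OF assms(2)]])

lemma radial_mean_0: "radial_mean w (\<lambda>_. 0) x = 0"
  by (simp add: radial_mean_def)

lemma const_if_vector_derivative_0:
  assumes "convex J" "t0 \<in> J" "t \<in> J" "\<And>t. t \<in> J \<Longrightarrow> (h has_vector_derivative 0) (at t)"
  shows "h t = h t0"
  using has_vector_derivative_zero_constant[OF assms(1), of h] assms(2-4)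
  by (metis has_vector_derivative_at_within)

lemma has_vector_derivative_shift:
  "(h has_vector_derivative h') (at (t - t0)) \<Longrightarrow> ((\<lambda>t. h (t - t0)) has_vector_derivative h') (at t)"
  using vector_diff_chain_at[of "\<lambda>t. t - t0" 1 t h h']
    has_vector_derivative_diff[OF has_vector_derivative_id has_vector_derivative_const, of t0 "at t"]
  by (simp add: o_def)

lemma base_only_translate: "base_only G \<Longrightarrow> base_only (\<lambda>w. G (P + w))"
  unfolding base_only_def by simp

lemma smooth_translate: "smooth G \<Longrightarrow> smooth (\<lambda>w. G (P + w))"
  by (rule smooth_affine_comp[OF bounded_linear_ident])

lemma cont_weights [simp]:
  "continuous_on {0..1} (\<lambda>s::real. 1 - s)" "continuous_on {0..1} (\<lambda>_. 1::real)"
  by (intro continuous_intros)+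

lemma base_only_radial_mean:
  fixes G :: "real^('n::finite coord) \<Rightarrow> 'b::euclidean_space"
  assumes "base_only G"
  shows "base_only (radial_mean w G)"
  unfolding base_only_def
proof (intro allI impI)
  fix P Q :: "real^('n coord)" assume "\<forall>c\<in>base. P $ c = Q $ c"
  hence "G (s *\<^sub>R P) = G (s *\<^sub>R Q)" for s
    by (intro base_onlyD[OF assms]) auto
  thus "radial_mean w G P = radial_mean w G Q" by (simp add: radial_mean_def)
qed

context smooth_gM
begin

text \<open>Integrating the geodesic equation twice along the straight line \<open>P + t v\<close>, which has the
  same unstarred coordinates as the geodesic, gives the deviation \<open>shear P (t v)\<close> from it.\<close>

definition shear :: "real^('n coord) \<Rightarrow> real^('n coord) \<Rightarrow> real^('n coord)" where
  "shear P v = ((1/2) * (v $ cX)\<^sup>2) *\<^sub>R radial_mean (\<lambda>s. 1 - s) (\<lambda>w. grad_star (P + w)) v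
     - (v $ cX * (radial_mean (\<lambda>_. 1) (\<lambda>w. H (P + w)) v - H P)) *\<^sub>R axis cXs 1"

definition geod :: "real^('n coord) \<Rightarrow> real^('n coord) \<Rightarrow> real \<Rightarrow> real^('n coord)" where
  "geod P v t = P + t *\<^sub>R v + shear P (t *\<^sub>R v)"

text \<open>The geodesic equation integrated once; the subtracted \<open>H P\<close> makes the
  initial velocity equal to \<open>v\<close>.\<close>

definition geod_vel :: "real^('n coord) \<Rightarrow> real^('n coord) \<Rightarrow> real \<Rightarrow> real^('n coord)" where
  "geod_vel P v t = v + ((1/2) * (v $ cX)\<^sup>2) *\<^sub>R (t *\<^sub>R radial_mean (\<lambda>_. 1) (\<lambda>w. grad_star (P + w)) (t *\<^sub>R v))
     - (v $ cX * (H (P + t *\<^sub>R v) - H P)) *\<^sub>R axis cXs 1"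

lemma smooth_shear: "smooth (shear P)"
  unfolding shear_def[abs_def] power2_eq_square
  by (intro smooth_intros smooth_radial_mean smooth_translate smooth_H smooth_grad_star cont_weights)

lemma unstarred_part_radial_grad:
  assumes "continuous_on {0..1} w"
  shows "unstarred_part (radial_mean w (\<lambda>w. grad_star (P + w)) v) = 0"
  using unstarred_part_grad_star unfolding unstarred_part_eq_0_iff
  by (simp add: radial_mean_nth[OF assms smooth_translate[OF smooth_grad_star]] radial_mean_0)

lemma unstarred_part_shear: "unstarred_part (shear P v) = 0"
  by (simp add: shear_def unstarred_part_simps unstarred_part_radial_grad unstarred_part_axis_cXs)

lemma shear_cong:
  assumes "unstarred_part u = unstarred_part v"
  shows "shear P u = shear P v"
proof -
  have uv: "\<forall>c\<in>insert cX base. u $ c = v $ c" using assms by (simp add: unstarred_part_eq_iff)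
  have "radial_mean w (\<lambda>w. H (P + w)) u = radial_mean w (\<lambda>w. H (P + w)) v"
    "radial_mean w (\<lambda>w. grad_star (P + w)) u = radial_mean w (\<lambda>w. grad_star (P + w)) v" for w
    using uv by (auto intro!: base_onlyD[OF base_only_radial_mean[OF base_only_translate[OF base_only_gM_xx]]]
      base_onlyD[OF base_only_radial_mean[OF base_only_translate[OF base_only_grad_star]]])
  thus ?thesis using uv by (simp add: shear_def)
qed

lemma shear_0: "shear P 0 = 0"
  by (simp add: shear_def)

lemma geod_0: "geod P v 0 = P" and geod_vel_0: "geod_vel P v 0 = v"
  by (simp_all add: geod_def geod_vel_def shear_0)

lemma unstarred_part_geod: "unstarred_part (geod P v t) = unstarred_part (P + t *\<^sub>R v)"
  by (simp add: geod_def unstarred_part_simps unstarred_part_shear)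

lemma unstarred_part_geod_vel: "unstarred_part (geod_vel P v t) = unstarred_part v"
  by (simp add: geod_vel_def unstarred_part_simps unstarred_part_radial_grad unstarred_part_axis_cXs)

lemma geod_has_vector_derivative: "(geod P v has_vector_derivative geod_vel P v t) (at t)"
proof -
  let ?M1 = "\<lambda>t. radial_mean (\<lambda>_. 1) (\<lambda>w. H (P + w)) (t *\<^sub>R v)"
  let ?M2 = "\<lambda>t. radial_mean (\<lambda>s. 1 - s) (\<lambda>w. grad_star (P + w)) (t *\<^sub>R v)"
  \<comment> \<open>Replacing \<open>v\<close> by \<open>t v\<close> turns the factors
    \<open>v $ cX\<close> into powers of \<open>t\<close>, so that the two radial primitives
    appear.\<close>
  have "geod P v = (\<lambda>t. P + t *\<^sub>R v + (((1/2) * (v $ cX)\<^sup>2) *\<^sub>R (t\<^sup>2 *\<^sub>R ?M2 t)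
     - (v $ cX * (t *\<^sub>R ?M1 t - t * H P)) *\<^sub>R axis cXs 1))"
    by (rule ext) (simp add: geod_def shear_def power2_eq_square algebra_simps)
  moreover have "((\<lambda>t. t\<^sup>2 *\<^sub>R ?M2 t) has_vector_derivative
      t *\<^sub>R radial_mean (\<lambda>_. 1) (\<lambda>w. grad_star (P + w)) (t *\<^sub>R v)) (at t)"
    by (rule radial_second_primitive[OF smooth_translate[OF smooth_grad_star]])
  moreover have "((\<lambda>t. t *\<^sub>R ?M1 t) has_vector_derivative H (P + t *\<^sub>R v)) (at t)"
    by (rule radial_primitive[OF smooth_translate[OF smooth_H]])
  moreover have "((\<lambda>t. P + t *\<^sub>R v + (c *\<^sub>R A t - (k * (B t - t * h)) *\<^sub>R e)) has_vector_derivative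
      v + c *\<^sub>R A' - (k * (B' - h)) *\<^sub>R e) (at t)"
    if "(A has_vector_derivative A') (at t)" "(B has_vector_derivative B') (at t)"
    for A B A' B' c h k and e :: "real^('n coord)"
    using that
    by (auto intro!: derivative_eq_intros simp: has_real_derivative_iff_has_vector_derivative)
  ultimately show ?thesis
    unfolding geod_vel_def by (simp only:)
qed

lemma geod_vel_has_vector_derivative:
  "(geod_vel P v has_vector_derivative - Gam (geod P v t) (geod_vel P v t) (geod_vel P v t)) (at t)"
proof -
  have "((\<lambda>t. t *\<^sub>R radial_mean (\<lambda>_. 1) (\<lambda>w. grad_star (P + w)) (t *\<^sub>R v))
      has_vector_derivative grad_star (P + t *\<^sub>R v)) (at t)"
    by (rule radial_primitive[OF smooth_translate[OF smooth_grad_star]])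
  moreover have "((\<lambda>t. H (P + t *\<^sub>R v)) has_vector_derivative dirderiv v H (P + t *\<^sub>R v)) (at t)"
    by (rule smooth_dirderiv_comp_line[OF smooth_H])
  moreover have "((\<lambda>t. v + c *\<^sub>R A t - (k * (B t - h)) *\<^sub>R e) has_vector_derivative
      c *\<^sub>R A' - (k * B') *\<^sub>R e) (at t)"
    if "(A has_vector_derivative A') (at t)" "(B has_vector_derivative B') (at t)"
    for A B A' B' c h k and e :: "real^('n coord)"
    using that
    by (auto intro!: derivative_eq_intros simp: has_real_derivative_iff_has_vector_derivative)
  ultimately have "(geod_vel P v has_vector_derivative ((1/2) * (v $ cX)\<^sup>2) *\<^sub>R grad_star (P + t *\<^sub>R v)
      - (v $ cX * dirderiv v H (P + t *\<^sub>R v)) *\<^sub>R axis cXs 1) (at t)"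
    unfolding geod_vel_def[abs_def] by (simp only:)
  moreover have "((1/2) * (v $ cX)\<^sup>2) *\<^sub>R grad_star (P + t *\<^sub>R v)
      - (v $ cX * dirderiv v H (P + t *\<^sub>R v)) *\<^sub>R axis cXs 1 = - Gam (P + t *\<^sub>R v) v v"
    by (simp add: Gam_def algebra_simps power2_eq_square flip: scaleR_add_left)
  \<comment> \<open>The curve differs from the line \<open>P + t v\<close> by a starred vector, to
    which \<open>Gam\<close> is insensitive.\<close>
  moreover have "Gam (P + t *\<^sub>R v) v v = Gam (geod P v t) (geod_vel P v t) (geod_vel P v t)"
    by (rule Gam_cong) (use unstarred_part_geod[of P v t] in \<open>auto simp: unstarred_part_geod_vel unstarred_part_eq_iff\<close>)
  ultimately show ?thesis by simp
qed

section \<open>Uniqueness of geodesics and completeness\<close>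

text \<open>\<open>Gam\<close> is starred-valued, so the unstarred velocity is constant and the
  unstarred position affine. The acceleration is then the same as for \<open>geod\<close>, and the
  differences of velocities and of positions have zero derivative in turn.\<close>

lemma geodesic_unique:
  assumes "convex J" "t0 \<in> J" "t \<in> J"
    and \<gamma>: "\<And>t. t \<in> J \<Longrightarrow> (\<gamma> has_vector_derivative v t) (at t)"
    and v: "\<And>t. t \<in> J \<Longrightarrow> (v has_vector_derivative - Gam (\<gamma> t) (v t) (v t)) (at t)"
  shows "\<gamma> t = geod (\<gamma> t0) (v t0) (t - t0)"
proof -
  let ?d = "\<lambda>t. geod (\<gamma> t0) (v t0) (t - t0)" and ?w = "\<lambda>t. geod_vel (\<gamma> t0) (v t0) (t - t0)"
  note const = const_if_vector_derivative_0[OF assms(1,2)]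
  note nth = bounded_linear.has_vector_derivative[OF bounded_linear_vec_nth]
  have G0: "Gam P u u' $ c = 0" if "c \<in> insert cX base" for P u u' c
    using unstarred_part_Gam[of P u u'] that unfolding unstarred_part_eq_0_iff by blast
  have vc: "v t $ c = v t0 $ c" if "t \<in> J" "c \<in> insert cX base" for t c
    using nth[OF v, of _ c] G0[OF that(2)] by (intro const[of _ "\<lambda>t. v t $ c"] that) auto
  have \<gamma>c: "\<gamma> t $ c = (\<gamma> t0 + (t - t0) *\<^sub>R v t0) $ c" if "t \<in> J" "c \<in> insert cX base" for t c
  proof -
    have "((\<lambda>t. \<gamma> t $ c - t * v t0 $ c) has_vector_derivative 0) (at t)" if "t \<in> J" for t
      using nth[OF \<gamma>[OF that], of c] vc[OF that \<open>c \<in> insert cX base\<close>]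
      by (auto intro!: derivative_eq_intros simp: has_real_derivative_iff_has_vector_derivative[symmetric])
    from const[OF \<open>t \<in> J\<close> this] show ?thesis by (simp add: algebra_simps)
  qed
  have vd: "(?d has_vector_derivative ?w t) (at t)"
    "(?w has_vector_derivative - Gam (?d t) (?w t) (?w t)) (at t)" for t
    by (intro has_vector_derivative_shift geod_has_vector_derivative geod_vel_has_vector_derivative)+
  have "v t - ?w t = v t0 - ?w t0" if "t \<in> J" for t
  proof (rule const[OF that, of "\<lambda>t. v t - ?w t"])
    fix t assume t: "t \<in> J"
    have "Gam (\<gamma> t) (v t) (v t) = Gam (?d t) (?w t) (?w t)"
    proof (rule Gam_cong)
      show "\<gamma> t $ c = ?d t $ c" if "c \<in> base" for c
        using \<gamma>c[OF t, of c] that unstarred_part_geod[of "\<gamma> t0" "v t0" "t - t0"]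
        by (simp add: unstarred_part_eq_iff)
    qed (use vc[OF t] in \<open>simp_all add: unstarred_part_geod_vel unstarred_part_eq_iff\<close>)
    thus "((\<lambda>t. v t - ?w t) has_vector_derivative 0) (at t)"
      using has_vector_derivative_diff[OF v[OF t] vd(2)[of t]] by simp
  qed
  hence "v t = ?w t" if "t \<in> J" for t using that by (simp add: geod_vel_0)
  hence "\<gamma> t - ?d t = \<gamma> t0 - ?d t0"
    using has_vector_derivative_diff[OF \<gamma> vd(1)]
    by (intro const[of t "\<lambda>t. \<gamma> t - ?d t"] assms) auto
  thus ?thesis by (simp add: geod_0)
qed

lemma is_geodesic_geod: "is_geodesic (gM f) J (\<lambda>t. geod P v (t - t0))"
proof -
  have "((\<lambda>t. geod P v (t - t0)) has_vector_derivative geod_vel P v (t - t0)) (at t)"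
    "((\<lambda>t. geod_vel P v (t - t0)) has_vector_derivative
      - Gam (geod P v (t - t0)) (geod_vel P v (t - t0)) (geod_vel P v (t - t0))) (at t)" for t
    by (intro has_vector_derivative_shift geod_has_vector_derivative geod_vel_has_vector_derivative)+
  thus ?thesis unfolding is_geodesic_def christoffel_vec_gM
    by (intro exI[of _ "\<lambda>t. geod_vel P v (t - t0)"]) blast
qed

lemma is_geodesic_eq_geod:
  assumes "convex J" "t0 \<in> J" "t \<in> J" "is_geodesic (gM f) J \<gamma>" "(\<gamma> has_vector_derivative v0) (at t0)"
  shows "\<gamma> t = geod (\<gamma> t0) v0 (t - t0)"
proof -
  obtain v where v: "\<forall>t\<in>J. (\<gamma> has_vector_derivative v t) (at t) \<and>
      (v has_vector_derivative - Gam (\<gamma> t) (v t) (v t)) (at t)"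
    using assms(4) unfolding is_geodesic_def christoffel_vec_gM by blast
  hence "\<gamma> t = geod (\<gamma> t0) (v t0) (t - t0)"
    by (intro geodesic_unique[OF assms(1-3)]) auto
  moreover have "v t0 = v0"
    using v assms(2,5) vector_derivative_unique_at by blast
  ultimately show ?thesis by simp
qed

lemma geodesically_complete_gM: "geodesically_complete (gM f)"
  unfolding geodesically_complete_def
proof (intro allI impI)
  fix J :: "real set" and \<gamma> assume J: "open J \<and> is_interval J \<and> is_geodesic (gM f) J \<gamma>"
  hence conv: "convex J" by (simp add: is_interval_convex)
  show "\<exists>\<gamma>'. is_geodesic (gM f) UNIV \<gamma>' \<and> (\<forall>t\<in>J. \<gamma>' t = \<gamma> t)"
  proof (cases "J = {}")
    case True
    \<comment> \<open>For an empty domain any complete geodesic is an extension.\<close>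
    thus ?thesis using is_geodesic_geod[of UNIV 0 0 0] by auto
  next
    case False
    then obtain t0 v0 where t0: "t0 \<in> J" "(\<gamma> has_vector_derivative v0) (at t0)"
      using J unfolding is_geodesic_def by blast
    with is_geodesic_eq_geod[OF conv t0(1)] J is_geodesic_geod[of UNIV "\<gamma> t0" v0 t0]
    show ?thesis by fastforce
  qed
qed

section \<open>The exponential map\<close>

text \<open>Existence comes from \<open>geod\<close>, uniqueness from
  \<open>is_geodesic_eq_geod\<close> on any interval containing 0 and 1. So the description in
  \<open>exp_map\<close> denotes a value for every \<open>v\<close>.\<close>

lemma exp_rel_gM: "exp_rel (gM f) P v Q \<longleftrightarrow> Q = P + v + shear P v"
proof
  assume "exp_rel (gM f) P v Q"
  then obtain J \<gamma> where J: "is_interval J" "{0..1} \<subseteq> J" "is_geodesic (gM f) J \<gamma>"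
    "\<gamma> 0 = P" "(\<gamma> has_vector_derivative v) (at 0)" "\<gamma> 1 = Q"
    unfolding exp_rel_def by blast
  have "\<gamma> 1 = geod (\<gamma> 0) v (1 - 0)"
    using J by (intro is_geodesic_eq_geod[of J]) (auto simp: is_interval_convex)
  thus "Q = P + v + shear P v" using J by (simp add: geod_def)
next
  assume "Q = P + v + shear P v"
  thus "exp_rel (gM f) P v Q"
    unfolding exp_rel_def
    using is_geodesic_geod[of UNIV P v 0] geod_has_vector_derivative[of P v 0]
    by (intro exI[of _ UNIV] exI[of _ "geod P v"]) (simp add: geod_0 geod_vel_0, simp add: geod_def)
qed

lemma exp_map_gM: "exp_map (gM f) P = (\<lambda>v. P + v + shear P v)"
  by (rule ext) (simp add: exp_map_def exp_rel_gM)

lemma exp_dom_gM: "exp_dom (gM f) P = UNIV"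
  by (auto simp: exp_dom_def exp_rel_gM)

lemma diffeomorphism_exp_map: "diffeomorphism (exp_map (gM f) P)"
proof (rule diffeomorphismI)
  \<comment> \<open>Adding a starred vector leaves \<open>shear\<close> unchanged, so subtracting
    the shear inverts the exponential map.\<close>
  have s: "shear P (v + shear P v) = shear P v" "shear P (v - shear P v) = shear P v" for v
    by (rule shear_cong, simp add: unstarred_part_simps unstarred_part_shear)+
  show "smooth (exp_map (gM f) P)"
    unfolding exp_map_gM by (intro smooth_intros smooth_shear)
  show "smooth (\<lambda>Q. (- P + Q) - shear P (- P + Q))"
    by (intro smooth_intros smooth_translate smooth_shear)
  show "(- P + exp_map (gM f) P v) - shear P (- P + exp_map (gM f) P v) = v" for v
    by (simp add: exp_map_gM s add.assoc)
  show "exp_map (gM f) P ((- P + Q) - shear P (- P + Q)) = Q" for Q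
    by (simp add: exp_map_gM s)
qed

end

section \<open>The curvature and its covariant derivatives\<close>

abbreviation dirderivs where "dirderivs vs F \<equiv> foldr dirderiv vs F"

lemma smooth_dirderivs: "smooth F \<Longrightarrow> smooth (dirderivs vs F)"
  by (induction vs) (auto intro: smooth_dirderiv)

lemma base_only_dirderivs: "smooth F \<Longrightarrow> base_only F \<Longrightarrow> base_only (dirderivs vs F)"
  by (induction vs) (auto intro: base_only_dirderiv smooth_dirderivs)

text \<open>A covariant derivative appends its direction to the argument list, which is the
  innermost place in \<open>foldr\<close>; Clairaut moves the outermost derivative there.\<close>

lemma dirderiv_dirderivs:
  fixes F :: "'a::euclidean_space \<Rightarrow> 'b::euclidean_space"
  assumes "smooth F"
  shows "dirderiv w (dirderivs vs F) = dirderivs (vs @ [w]) F"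
proof (induction vs)
  case (Cons v vs)
  have "dirderiv w (dirderiv v (dirderivs vs F)) = dirderiv v (dirderiv w (dirderivs vs F))"
    by (rule ext) (rule dirderiv_commute[OF smooth_dirderivs[OF assms]])
  thus ?case using Cons.IH by simp
qed simp

lemma dirderivs_eq_0:
  fixes F :: "real^('n::finite coord) \<Rightarrow> 'b::euclidean_space"
  assumes "smooth F" "base_only F"
  shows "\<exists>v\<in>set vs. \<forall>c\<in>base. v $ c = 0 \<Longrightarrow> dirderivs vs F P = 0"
proof (induction vs arbitrary: P)
  case (Cons v vs)
  show ?case
  proof (cases "\<forall>c\<in>base. v $ c = 0")
    case True
    thus ?thesis
      using base_only_dirderiv_0[OF base_only_dirderivs[OF assms] smooth_dirderivs[OF assms(1)]] by simp
  next
    case False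
    hence "dirderivs vs F = (\<lambda>_. 0)" using Cons by (intro ext) auto
    thus ?thesis by (simp add: dirderiv_const)
  qed
qed simp

lemma bounded_linear_unstarred_part: "bounded_linear unstarred_part"
  unfolding linear_conv_bounded_linear[symmetric] by (rule linearI) (simp_all add: unstarred_part_simps)

lemma bounded_linear_star_pairing: "bounded_linear (\<lambda>u. star_pairing u v)"
  unfolding linear_conv_bounded_linear[symmetric] by (rule linearI) (simp_all add: star_pairing_simps)

text \<open>A class of vector fields that contains the coordinate fields and is closed under \<open>nabla\<close>,
  so that the recursion for \<open>nabla_Riem\<close> stays inside it.\<close>

definition adapted :: "'n::finite coord vfield \<Rightarrow> bool" where
  "adapted V \<longleftrightarrow> smooth V \<and> (\<forall>P. unstarred_part (V P) = unstarred_part (V 0))"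

lemma adaptedD:
  assumes "adapted V"
  shows "smooth V" "unstarred_part (V P) = unstarred_part (V 0)"
  using assms unfolding adapted_def by auto

lemma adapted_base_nth:
  assumes "adapted V" "c \<in> base"
  shows "V P $ c = unstarred_part (V 0) $ c"
  using unstarred_part_nth(2)[OF assms(2), of "V P"] adaptedD(2)[OF assms(1), of P] by simp

lemma adapted_coord_field: "adapted (coord_field i)"
  by (simp add: adapted_def coord_field_def smooth_const)

lemma unstarred_part_dirderiv_adapted:
  assumes "adapted V"
  shows "unstarred_part (dirderiv u V P) = 0"
proof -
  have "unstarred_part (dirderiv u V P) = dirderiv u (\<lambda>x. unstarred_part (V x)) P"
    by (rule dirderiv_bounded_linear_comp[OF bounded_linear_unstarred_part adaptedD(1)[OF assms], symmetric])
  also have "(\<lambda>x. unstarred_part (V x)) = (\<lambda>_. unstarred_part (V 0))"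
    using adaptedD(2)[OF assms] by (rule ext)
  finally show ?thesis by (simp add: dirderiv_const)
qed

context smooth_gM
begin

lemma nabla_gM: "nabla (gM f) U V P = dirderiv (U P) V P + Gam P (U P) (V P)"
  by (simp add: nabla_def christoffel_vec_gM dirderiv_def)

lemma Gam_0: "unstarred_part u = 0 \<Longrightarrow> Gam P u v = 0" "unstarred_part v = 0 \<Longrightarrow> Gam P u v = 0"
proof -
  have "Gam P 0 v = 0" "Gam P u 0 = 0" for u v
    by (simp_all add: Gam_def dirderiv_zero_dir diff_H)
  thus "unstarred_part u = 0 \<Longrightarrow> Gam P u v = 0" "unstarred_part v = 0 \<Longrightarrow> Gam P u v = 0"
    using Gam_cong[of P P u 0 v v] Gam_cong[of P P u u v 0] by (simp_all add: unstarred_part_simps)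
qed

lemma smooth_Gam:
  assumes "smooth U" "smooth V"
  shows "smooth (\<lambda>P. Gam P (U P) (V P))"
  unfolding Gam_def
  by (intro smooth_intros smooth_dirderiv_field smooth_H smooth_grad_star assms)

lemma smooth_nabla:
  assumes "smooth U" "smooth V"
  shows "smooth (nabla (gM f) U V)"
  unfolding nabla_gM[abs_def]
  by (intro smooth_add smooth_dirderiv_field smooth_Gam assms)

text \<open>Both summands are starred, since \<open>V\<close> has a constant unstarred part and
  \<open>Gam\<close> is starred-valued. Hence each correction term in \<open>cov_deriv\<close>
  receives a starred argument, on which the curvature vanishes.\<close>

lemma unstarred_part_nabla:
  assumes "adapted V"
  shows "unstarred_part (nabla (gM f) U V P) = 0"
  by (simp add: nabla_gM unstarred_part_simps unstarred_part_dirderiv_adapted[OF assms] unstarred_part_Gam)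

lemma adapted_nabla:
  assumes "adapted U" "adapted V"
  shows "adapted (nabla (gM f) U V)"
  using smooth_nabla adaptedD(1) assms by (auto simp: adapted_def unstarred_part_nabla)

section \<open>Closed form of the curvature and its covariant derivatives\<close>

text \<open>With empty \<open>es\<close> this is half the Kulkarni-Nomizu product of the square of
  dx with the Hessian of \<open>H\<close>; the directions in \<open>es\<close> differentiate
  \<open>H\<close> further. Lists shorter than four get the default 0.\<close>

fun curv_form :: "(real^('n coord)) list \<Rightarrow> real^('n coord) \<Rightarrow> real" where
  "curv_form (u # v # w # y # es) = (\<lambda>P. (1/2) *
     (u $ cX * w $ cX * dirderivs (v # y # es) H P - v $ cX * w $ cX * dirderivs (u # y # es) H P
    + v $ cX * y $ cX * dirderivs (u # w # es) H P - u $ cX * y $ cX * dirderivs (v # w # es) H P))"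
| "curv_form _ = (\<lambda>_. 0)"

text \<open>The inner covariant derivative is starred, so the outer Christoffel term vanishes and no
  product of Christoffel symbols arises. With constant arguments in the inner \<open>Gam\<close>,
  only its dependence on the point is differentiated.\<close>

lemma nabla_nabla:
  assumes "adapted U" "adapted V" "adapted W"
  shows "nabla (gM f) U (nabla (gM f) V W) P = dirderiv (U P) (dirderiv (V P) W) P
    + dirderiv (dirderiv (U P) V P) W P
    + dirderiv (U P) (\<lambda>P. Gam P (unstarred_part (V 0)) (unstarred_part (W 0))) P"
proof -
  have "nabla (gM f) V W = (\<lambda>P. dirderiv (V P) W P + Gam P (unstarred_part (V 0)) (unstarred_part (W 0)))"
    unfolding nabla_gM[abs_def]
    using adaptedD(2)[OF assms(2)] adaptedD(2)[OF assms(3)]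
    by (intro ext arg_cong2[of _ _ _ _ "(+)"] Gam_cong) auto
  moreover have "smooth (\<lambda>P. dirderiv (V P) W P)" "smooth (\<lambda>P. Gam P (unstarred_part (V 0)) (unstarred_part (W 0)))"
    by (intro smooth_dirderiv_field smooth_Gam smooth_const adaptedD assms)+
  ultimately have "dirderiv (U P) (nabla (gM f) V W) P = dirderiv (U P) (\<lambda>P. dirderiv (V P) W P) P
    + dirderiv (U P) (\<lambda>P. Gam P (unstarred_part (V 0)) (unstarred_part (W 0))) P"
    by (simp add: dirderiv_add)
  thus ?thesis
    unfolding nabla_gM[of U]
    by (simp add: Gam_0(2) unstarred_part_nabla assms dirderiv_dirderiv_field adaptedD(1))
qed

lemma star_pairing_dirderiv_Gam:
  "star_pairing (dirderiv a (\<lambda>P. Gam P v w) P) y = (1/2) * (v $ cX * y $ cX * dirderivs [a, w] H P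
    + w $ cX * y $ cX * dirderivs [a, v] H P - v $ cX * w $ cX * dirderivs [a, y] H P)"
proof -
  have "star_pairing (dirderiv a (\<lambda>P. Gam P v w) P) y = dirderiv a (\<lambda>P. star_pairing (Gam P v w) y) P"
    by (rule dirderiv_bounded_linear_comp[OF bounded_linear_star_pairing, symmetric])
      (intro smooth_Gam smooth_const)
  also have "\<dots> = dirderiv a (\<lambda>P. (1/2) * (v $ cX * y $ cX * dirderiv w H P
    + w $ cX * y $ cX * dirderiv v H P - v $ cX * w $ cX * dirderiv y H P)) P"
    unfolding star_pairing_commute[of _ y] star_pairing_Gam ..
  also have "\<dots> = (1/2) * (v $ cX * y $ cX * dirderivs [a, w] H P
    + w $ cX * y $ cX * dirderivs [a, v] H P - v $ cX * w $ cX * dirderivs [a, y] H P)"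
    by (simp add: dirderiv_mult dirderiv_add dirderiv_diff dirderiv_const dirderiv_divide smooth_intros smooth_H)
  finally show ?thesis .
qed

lemma Riem_adapted:
  assumes "adapted U" "adapted V" "adapted W" "adapted Y"
  shows "Riem (gM f) U V W Y P = curv_form (map (\<lambda>V. unstarred_part (V 0)) [U, V, W, Y]) P"
proof -
  let ?u = "unstarred_part (U 0)" and ?v = "unstarred_part (V 0)"
    and ?w = "unstarred_part (W 0)" and ?y = "unstarred_part (Y 0)"
  have lb: "lie_bracket U V P = dirderiv (U P) V P - dirderiv (V P) U P"
    by (simp add: lie_bracket_def dirderiv_def)
  \<comment> \<open>The bracket of adapted fields is starred, so \<open>Gam\<close> contributes
    nothing.\<close>
  have "nabla (gM f) (lie_bracket U V) W P = dirderiv (dirderiv (U P) V P) W P - dirderiv (dirderiv (V P) U P) W P"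
    unfolding nabla_gM[of "lie_bracket U V"] lb
    by (simp add: Gam_0(1) unstarred_part_simps unstarred_part_dirderiv_adapted assms
        dirderiv_diff_dir smooth_differentiable[OF adaptedD(1)[OF assms(3)]])
  \<comment> \<open>Clairaut and the bracket term cancel all derivatives of \<open>W\<close>; only
    derivatives of \<open>Gam\<close> remain.\<close>
  hence c: "curv_op (gM f) U V W P = dirderiv (U P) (\<lambda>P. Gam P ?v ?w) P - dirderiv (V P) (\<lambda>P. Gam P ?u ?w) P"
    unfolding curv_op_def
    by (simp add: nabla_nabla assms dirderiv_commute[OF adaptedD(1)[OF assms(3)], of "V P" "U P"])
  have u0: "unstarred_part (curv_op (gM f) U V W P) = 0"
    unfolding curv_op_def using assms adapted_nabla
    by (simp add: unstarred_part_simps unstarred_part_nabla)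
  have "Riem (gM f) U V W Y P = star_pairing (curv_op (gM f) U V W P) ?y"
    unfolding Riem_def ginner_gM using u0 star_pairing_unstarred[OF u0, of "Y P"] adaptedD(2)[OF assms(4), of P]
    by (simp add: unstarred_part_eq_0_iff)
  also have "\<dots> = curv_form [?u, ?v, ?w, ?y] P"
  proof -
    \<comment> \<open>Derivatives of \<open>H\<close> see only base components, so the value of a
      field at \<open>P\<close> may be replaced by its constant unstarred part.\<close>
    have d: "dirderiv (X P) (dirderiv z H) P = dirderiv (unstarred_part (X 0)) (dirderiv z H) P"
      if "adapted X" for X z
      by (intro base_only_dirderiv_cong base_only_dirderiv base_only_gM_xx smooth_dirderiv smooth_H
          adapted_base_nth that)
    show ?thesis
      unfolding c star_pairing_simps star_pairing_dirderiv_Gam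
      by (simp add: d assms dirderiv_commute[OF smooth_H, of ?v ?u] algebra_simps)
  qed
  finally show ?thesis by simp
qed

lemma length_ge_4_cases:
  assumes "length vs = k + 4"
  obtains u v w y es where "vs = u # v # w # y # es" "length es = k"
  using assms by (auto simp: numeral_eq_Suc length_Suc_conv)

lemma curv_form_eq_0:
  assumes "0 \<in> set vs" "length vs = k + 4"
  shows "curv_form vs P = 0"
proof -
  obtain u v w y es where vs: "vs = u # v # w # y # es" using length_ge_4_cases[OF assms(2)] by metis
  have D: "dirderivs us H P = 0" if "0 \<in> set us" for us
    by (rule dirderivs_eq_0[OF smooth_H base_only_gM_xx]) (use that in force)
  show ?thesis using assms(1) D[of "_ # _ # es"] unfolding vs by auto
qed

lemma smooth_curv_form: "smooth (curv_form vs)"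
  and base_only_curv_form: "base_only (curv_form vs)"
  and dirderiv_curv_form: "length vs = k + 4 \<Longrightarrow> dirderiv a (curv_form vs) P = curv_form (vs @ [a]) P"
proof -
  show "smooth (curv_form vs)"
    by (cases vs rule: curv_form.cases)
      (simp_all only: curv_form.simps, (intro smooth_intros smooth_dirderivs smooth_H)+)
  have b: "base_only (dirderivs us H)" for us
    by (rule base_only_dirderivs[OF smooth_H base_only_gM_xx])
  show "base_only (curv_form vs)"
    unfolding base_only_def
  proof (intro allI impI)
    fix P Q :: "real^('n coord)" assume "\<forall>c\<in>base. P $ c = Q $ c"
    hence "dirderivs us H P = dirderivs us H Q" for us by (intro base_onlyD[OF b]) auto
    thus "curv_form vs P = curv_form vs Q" by (cases vs rule: curv_form.cases) (auto simp del: foldr.simps)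
  qed
  assume "length vs = k + 4"
  then obtain u v w y es where vs: "vs = u # v # w # y # es" using length_ge_4_cases by metis
  have D: "dirderiv a (dirderivs us H) P = dirderivs (us @ [a]) H P" for us
    by (simp add: dirderiv_dirderivs[OF smooth_H])
  show "dirderiv a (curv_form vs) P = curv_form (vs @ [a]) P"
    unfolding vs curv_form.simps append_Cons
    by (simp add: dirderiv_mult dirderiv_add dirderiv_diff dirderiv_const dirderiv_divide smooth_intros
        smooth_dirderivs smooth_H D del: foldr.simps foldr_append flip: append_Cons)
qed

text \<open>Each correction term of the covariant derivative has a starred argument and vanishes by
  \<open>curv_form_eq_0\<close>; the remaining flat derivative appends its direction by
  \<open>dirderiv_curv_form\<close>.\<close>

lemma nabla_Riem_adapted:
  assumes "length Vs = k + 4" "\<And>V. V \<in> set Vs \<Longrightarrow> adapted V"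
  shows "nabla_Riem (gM f) k Vs P = curv_form (map (\<lambda>V. unstarred_part (V 0)) Vs) P"
  using assms
proof (induction k arbitrary: Vs P)
  case 0
  then obtain U V W Y where "Vs = [U, V, W, Y]"
    using length_ge_4_cases[OF 0(1)] by (metis length_0_conv)
  thus ?case using Riem_adapted[of U V W Y P] 0(2) by (simp add: numeral_eq_Suc)
next
  case (Suc k)
  let ?c = "\<lambda>V. unstarred_part (V 0)"
  obtain Ys W where Vs: "Vs = Ys @ [W]" using Suc.prems(1) by (cases Vs rule: rev_cases) auto
  have len: "length Ys = k + 4" and ad: "\<And>V. V \<in> set Ys \<Longrightarrow> adapted V" "adapted W"
    using Suc.prems by (auto simp: Vs)
  have T: "nabla_Riem (gM f) k Ys = curv_form (map ?c Ys)"
    by (rule ext) (rule Suc.IH[OF len ad(1)])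
  have "nabla_Riem (gM f) k (Ys[j := nabla (gM f) W (Ys ! j)]) P = 0" if j: "j < length Ys" for j
  proof -
    let ?Z = "Ys[j := nabla (gM f) W (Ys ! j)]"
    have aj: "adapted (Ys ! j)" using ad(1) j by auto
    have "nabla_Riem (gM f) k ?Z P = curv_form (map ?c ?Z) P"
      using len ad adapted_nabla[OF ad(2) aj] set_update_subset_insert[of Ys j "nabla (gM f) W (Ys ! j)"]
      by (intro Suc.IH) auto
    also have "\<dots> = 0"
    proof (rule curv_form_eq_0)
      have "map ?c ?Z ! j = 0" using j by (simp add: unstarred_part_nabla[OF aj])
      thus "0 \<in> set (map ?c ?Z)" using j by (metis length_list_update length_map nth_mem)
    qed (simp add: len)
    finally show ?thesis .
  qed
  hence "nabla_Riem (gM f) (Suc k) Vs P = dirderiv (W P) (curv_form (map ?c Ys)) P"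
    by (simp add: cov_deriv_def Vs T dirderiv_def)
  also have "\<dots> = dirderiv (?c W) (curv_form (map ?c Ys)) P"
    by (intro base_only_dirderiv_cong base_only_curv_form smooth_curv_form adapted_base_nth ad)
  also have "\<dots> = curv_form (map ?c Vs) P"
    using dirderiv_curv_form[of "map ?c Ys" k] len by (simp add: Vs)
  finally show ?case .
qed

section \<open>Coordinate components of the curvature and its derivatives\<close>

lemma nabla_Riem_comp_gM:
  assumes "length idx = k + 4"
  shows "nabla_Riem_comp (gM f) k idx P = curv_form (map (\<lambda>i. unstarred_part (axis i 1)) idx) P"
  unfolding nabla_Riem_comp_def using assms
  by (subst nabla_Riem_adapted) (auto simp: adapted_coord_field[unfolded coord_field_def] coord_field_def o_def)

lemma unstarred_part_axis:
  "unstarred_part (axis i 1) = (if i \<in> insert cX base then axis i 1 else 0)"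
  by (auto simp: unstarred_part_def axis_def vec_eq_iff)

lemma nabla_Riem_comp_unstarred:
  assumes "length idx = k + 4" "set idx \<subseteq> insert cX base"
  shows "nabla_Riem_comp (gM f) k idx P = curv_form (map (\<lambda>i. axis i 1) idx) P"
  unfolding nabla_Riem_comp_gM[OF assms(1)]
  by (rule arg_cong[of _ _ "\<lambda>l. curv_form l P"]) (use assms(2) in \<open>auto simp: unstarred_part_axis\<close>)

lemma nabla_Riem_comp_nonzero:
  assumes "nabla_Riem_comp (gM f) k idx P \<noteq> 0" "length idx = k + 4"
  shows "set idx \<subseteq> insert cX base"
proof (rule ccontr)
  assume "\<not> set idx \<subseteq> insert cX base"
  then obtain i where "i \<in> set idx" "i \<notin> insert cX base" by blast
  hence "0 \<in> set (map (\<lambda>i. unstarred_part (axis i 1)) idx)"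
    by (force simp: unstarred_part_axis)
  from curv_form_eq_0[OF this, of k P] show False using assms by (simp add: nabla_Riem_comp_gM)
qed

lemma dirderivs_axis_cX: "axis cX 1 \<in> set vs \<Longrightarrow> dirderivs vs H P = 0"
  by (rule dirderivs_eq_0[OF smooth_H base_only_gM_xx]) (auto simp: axis_def intro!: bexI[of _ "axis cX 1"])

lemma foldr_partial: "foldr partial is F P = dirderivs (map (\<lambda>i. axis i 1) is) F P"
proof -
  have "foldr partial is F = dirderivs (map (\<lambda>i. axis i 1) is) F"
    by (induction "is") (auto simp: partial_def dirderiv_def)
  thus ?thesis by simp
qed

lemma gM_cX_cX: "(\<lambda>Q. gM f Q $ cX $ cX) = H"
  by (simp add: gM_def)

lemma axis_cX_base: "c \<in> base \<Longrightarrow> axis c 1 $ cX = (0::real)"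
  by (auto simp: axis_def)

text \<open>In each pattern exactly one of the four terms of \<open>curv_form\<close> has a non-zero
  coefficient; the signs reflect the antisymmetry in both index pairs.\<close>

lemma nabla_Riem_comp_nonzero_values:
  fixes P :: "real^('n coord)"
  assumes "length es = k" "{b, c} \<union> set es \<subseteq> base"
  defines "r \<equiv> - (1/2) * foldr partial (b # c # es) (\<lambda>Q. gM f Q $ cX $ cX) P"
  shows "nabla_Riem_comp (gM f) k ([cX, b, c, cX] @ es) P = r"
    "nabla_Riem_comp (gM f) k ([b, cX, c, cX] @ es) P = - r"
    "nabla_Riem_comp (gM f) k ([cX, b, cX, c] @ es) P = - r"
    "nabla_Riem_comp (gM f) k ([b, cX, cX, c] @ es) P = r"
proof -
  let ?D = "dirderivs (axis b 1 # axis c 1 # map (\<lambda>i. axis i 1) es) H P"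
  have r: "r = - (1/2) * ?D" unfolding r_def foldr_partial gM_cX_cX by simp
  have x: "axis b 1 $ cX = (0::real)" "axis c 1 $ cX = (0::real)" "axis cX 1 $ cX = (1::real)"
    using assms(2) by (auto simp: axis_cX_base)
  show "nabla_Riem_comp (gM f) k ([cX, b, c, cX] @ es) P = r"
    "nabla_Riem_comp (gM f) k ([b, cX, c, cX] @ es) P = - r"
    "nabla_Riem_comp (gM f) k ([cX, b, cX, c] @ es) P = - r"
    "nabla_Riem_comp (gM f) k ([b, cX, cX, c] @ es) P = r"
    unfolding r
    by (subst nabla_Riem_comp_unstarred, use assms in simp, use assms in force,
        simp add: x del: foldr.simps)+
qed

text \<open>Each term of \<open>curv_form\<close> takes one \<open>cX\<close> from each of the first
  two index pairs as coefficient and differentiates \<open>H\<close> in all other slots, where a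
  further \<open>cX\<close> gives 0.\<close>

lemma nabla_Riem_comp_nonzero_shape:
  assumes "length idx = k + 4" "nabla_Riem_comp (gM f) k idx P \<noteq> 0"
  shows "\<exists>b c es. {b, c} \<union> set es \<subseteq> base \<and>
    idx \<in> {[cX, b, c, cX] @ es, [b, cX, c, cX] @ es, [cX, b, cX, c] @ es, [b, cX, cX, c] @ es}"
proof -
  obtain i j k' l es where idx: "idx = i # j # k' # l # es"
    using length_ge_4_cases[OF assms(1)] by metis
  have us: "set idx \<subseteq> insert cX base" by (rule nabla_Riem_comp_nonzero[OF assms(2,1)])
  let ?e = "\<lambda>i. axis i 1 :: real^('n coord)"
  have nz: "curv_form (map ?e idx) P \<noteq> 0"
    using assms(2) nabla_Riem_comp_unstarred[OF assms(1) us] by simp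
  have D: "dirderivs (?e a # ?e b # map ?e es) H P = 0" if "a = cX \<or> b = cX \<or> cX \<in> set es" for a b
    by (rule dirderivs_axis_cX) (use that in auto)
  have es: "set es \<subseteq> base"
  proof (rule ccontr)
    assume "\<not> set es \<subseteq> base"
    hence "cX \<in> set es" using us by (auto simp: idx)
    thus False using nz D by (simp add: idx del: foldr.simps)
  qed
  have "i \<in> insert cX base" "j \<in> insert cX base" "k' \<in> insert cX base" "l \<in> insert cX base"
    using us by (auto simp: idx)
  with nz es D show ?thesis
    unfolding idx
    by (elim insertE) (auto simp: axis_cX_base simp del: foldr.simps)
qed

subsection \<open>Scalar Weyl invariants\<close>

lemma weyl_prod_nonzero:
  "length idx = weyl_rank ks \<Longrightarrow> weyl_prod (gM f) ks idx P \<noteq> 0 \<Longrightarrow> set idx \<subseteq> insert cX base"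
proof (induction ks arbitrary: idx)
  case (Cons k ks)
  hence "set (take (k + 4) idx) \<subseteq> insert cX base" "set (drop (k + 4) idx) \<subseteq> insert cX base"
    using nabla_Riem_comp_nonzero[of k "take (k + 4) idx" P] by (auto simp: weyl_rank_def)
  thus ?case by (metis append_take_drop_id set_append Un_least)
qed (simp add: weyl_rank_def)

lemma weyl_contraction_gM:
  assumes "ks \<noteq> []" "index_pairing (weyl_rank ks) ps"
  shows "weyl_contraction (gM f) ks ps P = 0"
  unfolding weyl_contraction_def
proof (rule sum.neutral, safe)
  fix idx :: "'n coord list" assume len: "length idx = weyl_rank ks"
  \<comment> \<open>A non-empty product has at least four indices, so there is a pair to
    contract.\<close>
  have "weyl_rank ks \<noteq> 0" using assms(1) by (cases ks) (auto simp: weyl_rank_def)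
  then obtain a b where ab: "(a, b) \<in> set ps"
    using assms(2) unfolding index_pairing_def by (cases ps) auto
  hence lt: "a < length idx" "b < length idx"
    using assms(2) unfolding index_pairing_def len by force+
  show "(\<Prod>(a, b)\<leftarrow>ps. matrix_inv (gM f P) $ (idx ! a) $ (idx ! b)) * weyl_prod (gM f) ks idx P = 0"
  proof (cases "weyl_prod (gM f) ks idx P = 0")
    case False
    from weyl_prod_nonzero[OF len False] lt
    have m: "idx ! a \<in> insert cX base" "idx ! b \<in> insert cX base" by (meson nth_mem subsetD)+
    \<comment> \<open>The inverse metric can be non-zero only at dual pairs and at
      \<open>cXs\<close>, \<open>cXs\<close>; neither consists of two unstarred indices.\<close>
    have "idx ! b \<noteq> star (idx ! a)" using m star_unstarred[of "idx ! a"] by metis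
    moreover have "idx ! a \<noteq> cXs" using m by auto
    ultimately have "matrix_inv (gM f P) $ (idx ! a) $ (idx ! b) = 0" by (simp add: matrix_inv_gM)
    thus ?thesis using ab by (force simp: prod_list_zero_iff)
  qed simp
qed

lemma weyl_invariants_gM: "F \<in> weyl_invariants (gM f) \<Longrightarrow> F P = 0"
  by (induction arbitrary: P rule: weyl_invariants.induct) (auto simp: weyl_contraction_gM)

end

section \<open>Symmetric spaces\<close>

lemma bounded_bilinear_star_pairing: "bounded_bilinear star_pairing"
  unfolding bilinear_conv_bounded_bilinear[symmetric] bilinear_def
  by (intro conjI allI linearI) (simp_all add: star_pairing_simps)

text \<open>The second derivative appears in the form in which \<open>isometry_connection\<close>
  supplies it when \<open>v\<close> is the velocity of the curve.\<close>

lemma has_vector_derivative_dirderiv_curve: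
  fixes F :: "real^'i::finite \<Rightarrow> 'b::euclidean_space"
  assumes "smooth F" "(\<gamma> has_vector_derivative \<gamma>') (at t)" "(v has_vector_derivative v') (at t)"
  shows "((\<lambda>t. dirderiv (v t) F (\<gamma> t)) has_vector_derivative
    dirderiv (v t) (dirderiv \<gamma>' F) (\<gamma> t) + dirderiv v' F (\<gamma> t)) (at t)"
proof -
  have "((\<lambda>t. \<Sum>i\<in>UNIV. v t $ i *\<^sub>R dirderiv (axis i 1) F (\<gamma> t)) has_vector_derivative
     (\<Sum>i\<in>UNIV. v t $ i *\<^sub>R dirderiv \<gamma>' (dirderiv (axis i 1) F) (\<gamma> t)
        + v' $ i *\<^sub>R dirderiv (axis i 1) F (\<gamma> t))) (at t)"
    by (intro has_vector_derivative_sum has_vector_derivative_scaleR smooth_vector_derivative_comp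
        smooth_dirderiv assms)
      (simp add: has_real_derivative_iff_has_vector_derivative
        bounded_linear.has_vector_derivative[OF bounded_linear_vec_nth] assms)
  moreover have "(\<lambda>t. \<Sum>i\<in>UNIV. v t $ i *\<^sub>R dirderiv (axis i 1) F (\<gamma> t)) = (\<lambda>t. dirderiv (v t) F (\<gamma> t))"
    by (rule ext) (rule dirderiv_expand[OF smooth_differentiable[OF assms(1)], symmetric])
  ultimately show ?thesis
    unfolding sum.distrib dirderiv_commute[OF assms(1), of \<gamma>']
      dirderiv_expand[OF smooth_differentiable[OF smooth_dirderiv[OF assms(1)]], symmetric]
      dirderiv_expand[OF smooth_differentiable[OF assms(1)], symmetric]
    by simp
qed

context smooth_gM
begin

lemma Gam_nth_cX: "Gam P u v $ cX = 0"
  using unstarred_part_Gam[of P u v] by (simp add: unstarred_part_eq_0_iff)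

text \<open>The isometry equation is differentiated along \<open>a\<close>; as \<open>u\<close> and
  \<open>w\<close> are constant, only \<open>gM_xx\<close> varies on the right.\<close>

lemma isometry_derivative:
  fixes P :: "real^('n coord)"
  assumes \<phi>: "smooth \<phi>"
    and iso: "\<And>P u v. ginner (gM f) (\<phi> P) (dirderiv u \<phi> P) (dirderiv v \<phi> P) = ginner (gM f) P u v"
  shows "dirderiv (dirderiv a \<phi> P) H (\<phi> P) * dirderiv u \<phi> P $ cX * dirderiv w \<phi> P $ cX
    + ginner (gM f) (\<phi> P) (dirderiv a (dirderiv u \<phi>) P) (dirderiv w \<phi> P)
    + ginner (gM f) (\<phi> P) (dirderiv u \<phi> P) (dirderiv a (dirderiv w \<phi>) P)
    = dirderiv a H P * u $ cX * w $ cX" (is "?l = ?r")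
proof -
  let ?U = "dirderiv u \<phi>" and ?W = "dirderiv w \<phi>"
  have hU: "(?U has_derivative (\<lambda>a. dirderiv a ?U P)) (at P)"
    and hW: "(?W has_derivative (\<lambda>a. dirderiv a ?W P)) (at P)"
    by (intro smooth_has_derivative smooth_dirderiv \<phi>)+
  have hH: "((\<lambda>Q. H (\<phi> Q)) has_derivative (\<lambda>a. dirderiv (dirderiv a \<phi> P) H (\<phi> P))) (at P)"
    by (rule has_derivative_compose[OF smooth_has_derivative[OF \<phi>] smooth_has_derivative[OF smooth_H]])
  note nth = bounded_linear.has_derivative[OF bounded_linear_vec_nth]
  have "((\<lambda>Q. ginner (gM f) (\<phi> Q) (?U Q) (?W Q)) has_derivative (\<lambda>a.
      H (\<phi> P) * ?U P $ cX * dirderiv a ?W P $ cX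
      + (H (\<phi> P) * dirderiv a ?U P $ cX + dirderiv (dirderiv a \<phi> P) H (\<phi> P) * ?U P $ cX) * ?W P $ cX
      + (star_pairing (?U P) (dirderiv a ?W P) + star_pairing (dirderiv a ?U P) (?W P)))) (at P)"
    unfolding ginner_gM
    by (intro has_derivative_add has_derivative_mult nth hH hU hW
        bounded_bilinear.FDERIV[OF bounded_bilinear_star_pairing hU hW])
  from dirderiv_eqI[OF this, of a]
  have "dirderiv a (\<lambda>Q. ginner (gM f) (\<phi> Q) (?U Q) (?W Q)) P = ?l"
    by (simp add: ginner_gM algebra_simps)
  moreover have "dirderiv a (\<lambda>Q. ginner (gM f) (\<phi> Q) (?U Q) (?W Q)) P = ?r"
    unfolding iso unfolding ginner_gM
    by (simp add: dirderiv_add dirderiv_mult dirderiv_const smooth_intros smooth_H)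
  ultimately show ?thesis by simp
qed

lemma ginner_commute: "ginner (gM f) P u v = ginner (gM f) P v u"
  by (simp add: ginner_gM star_pairing_commute[of u])

lemma ginner_add_right: "ginner (gM f) P u (v + w) = ginner (gM f) P u v + ginner (gM f) P u w"
  by (simp add: ginner_gM star_pairing_simps algebra_simps)

text \<open>Combining the derivatives of the isometry equation as in Koszul's formula gives the
  connection.\<close>

lemma isometry_connection:
  fixes P :: "real^('n coord)"
  assumes \<phi>: "smooth \<phi>"
    and iso: "\<And>P u v. ginner (gM f) (\<phi> P) (dirderiv u \<phi> P) (dirderiv v \<phi> P) = ginner (gM f) P u v"
  shows "dirderiv u (dirderiv u \<phi>) P + Gam (\<phi> P) (dirderiv u \<phi> P) (dirderiv u \<phi> P)
    = dirderiv (Gam P u u) \<phi> P"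
proof (rule ginner_nondegenerate[OF gM_invertible])
  fix w'
  let ?A = "\<lambda>w. dirderiv w \<phi> P"
  have lin: "linear ?A"
    using smooth_has_derivative[OF \<phi>] by (rule has_derivative_linear)
  \<comment> \<open>The differential preserves a nondegenerate form, so it is injective and, by
    equality of dimensions, onto. Every test vector is therefore the image of some
    \<open>w\<close>.\<close>
  have "inj ?A"
  proof (subst linear_injective_0[OF lin], intro allI impI)
    fix w assume "?A w = 0"
    hence "ginner (gM f) P v w = ginner (gM f) P v 0" for v
      using iso[of P v w] iso[of P v 0] by (simp add: linear_0[OF lin])
    thus "w = 0" by (rule ginner_nondegenerate[OF gM_invertible])
  qed
  hence "surj ?A" by (rule linear_inj_imp_surj[OF lin])
  then obtain w where w: "w' = ?A w" by (metis surjD)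
  have 1: "ginner (gM f) (\<phi> P) (?A w) (dirderiv (Gam P u u) \<phi> P)
     = u $ cX * w $ cX * dirderiv u H P - (1/2) * u $ cX * u $ cX * dirderiv w H P"
    unfolding iso by (simp add: ginner_gM Gam_nth_cX star_pairing_Gam)
  have 2: "ginner (gM f) (\<phi> P) (?A w) (Gam (\<phi> P) (?A u) (?A u))
     = ?A u $ cX * ?A w $ cX * dirderiv (?A u) H (\<phi> P) - (1/2) * ?A u $ cX * ?A u $ cX * dirderiv (?A w) H (\<phi> P)"
    by (simp add: ginner_gM Gam_nth_cX star_pairing_Gam)
  have 3: "dirderiv u (dirderiv w \<phi>) P = dirderiv w (dirderiv u \<phi>) P"
    by (rule dirderiv_commute[OF \<phi>])
  show "ginner (gM f) (\<phi> P) w' (dirderiv u (dirderiv u \<phi>) P + Gam (\<phi> P) (?A u) (?A u))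
     = ginner (gM f) (\<phi> P) w' (dirderiv (Gam P u u) \<phi> P)"
    unfolding w ginner_add_right 1 2
    \<comment> \<open>In the first instance minus half the second, the terms with the mixed
      derivative cancel by 3.\<close>
    using isometry_derivative[OF assms, of u P u w] isometry_derivative[OF assms, of w P u u]
    unfolding 3 ginner_commute[of "\<phi> P" "?A w" "dirderiv u (dirderiv u \<phi>) P"]
      ginner_commute[of "\<phi> P" "dirderiv w (dirderiv u \<phi>) P" "?A u"]
    by (simp add: mult.assoc) (simp add: algebra_simps)
qed

text \<open>By \<open>isometry_connection\<close> the image curve satisfies the geodesic equation,
  and \<open>geodesic_unique\<close> identifies it.\<close>

lemma isometry_geod:
  assumes \<phi>: "smooth \<phi>"
    and iso: "\<And>P u v. ginner (gM f) (\<phi> P) (dirderiv u \<phi> P) (dirderiv v \<phi> P) = ginner (gM f) P u v"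
  shows "\<phi> (geod P v t) = geod (\<phi> P) (dirderiv v \<phi> P) t"
proof -
  let ?\<gamma> = "geod P v" and ?v = "geod_vel P v"
  have "\<phi> (?\<gamma> t) = geod (\<phi> (?\<gamma> 0)) (dirderiv (?v 0) \<phi> (?\<gamma> 0)) (t - 0)"
  proof (rule geodesic_unique[of UNIV 0 t "\<lambda>t. \<phi> (?\<gamma> t)" "\<lambda>t. dirderiv (?v t) \<phi> (?\<gamma> t)"])
    fix t
    show "((\<lambda>t. \<phi> (?\<gamma> t)) has_vector_derivative dirderiv (?v t) \<phi> (?\<gamma> t)) (at t)"
      by (rule smooth_vector_derivative_comp[OF \<phi> geod_has_vector_derivative])
    have "dirderiv (?v t) (dirderiv (?v t) \<phi>) (?\<gamma> t) + dirderiv (- Gam (?\<gamma> t) (?v t) (?v t)) \<phi> (?\<gamma> t)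
       = - Gam (\<phi> (?\<gamma> t)) (dirderiv (?v t) \<phi> (?\<gamma> t)) (dirderiv (?v t) \<phi> (?\<gamma> t))"
      using isometry_connection[OF assms, of "?v t" "?\<gamma> t"]
      by (simp add: dirderiv_minus_dir[OF smooth_differentiable[OF \<phi>]] algebra_simps)
    thus "((\<lambda>t. dirderiv (?v t) \<phi> (?\<gamma> t)) has_vector_derivative
        - Gam (\<phi> (?\<gamma> t)) (dirderiv (?v t) \<phi> (?\<gamma> t)) (dirderiv (?v t) \<phi> (?\<gamma> t))) (at t)"
      using has_vector_derivative_dirderiv_curve[OF \<phi> geod_has_vector_derivative[of P v t]
          geod_vel_has_vector_derivative[of P v t]] by simp
  qed auto
  thus ?thesis by (simp add: geod_0 geod_vel_0)
qed

section \<open>Point reflections and the third derivatives of the metric\<close>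

lemma point_reflection_formula:
  assumes \<phi>: "smooth \<phi>"
    and iso: "\<And>P u v. ginner (gM f) (\<phi> P) (dirderiv u \<phi> P) (dirderiv v \<phi> P) = ginner (gM f) P u v"
    and fixed: "\<phi> P = P" and reflects: "\<And>v. dirderiv v \<phi> P = - v"
  shows "\<phi> (P + w) = P - w + (shear P w + shear P (- w))"
proof -
  have s: "shear P (w - shear P w) = shear P w" "shear P (shear P w - w) = shear P (- w)"
    by (rule shear_cong, simp add: unstarred_part_simps unstarred_part_shear)+
  show ?thesis
    \<comment> \<open>The geodesic with initial velocity \<open>w - shear P w\<close> is at
      \<open>P + w\<close> at time 1; its image starts with the opposite velocity.\<close>
    using isometry_geod[OF \<phi> iso, of P "w - shear P w" 1]
    by (simp add: geod_def fixed reflects s algebra_simps)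
qed

lemma shear_nth_star:
  assumes "b \<in> base"
  shows "shear P w $ star b
    = (1/2) * (w $ cX)\<^sup>2 * radial_mean (\<lambda>s. 1 - s) (\<lambda>w. dirderiv (axis b 1) H (P + w)) w"
proof -
  have "star b \<noteq> cXs" using assms by auto
  thus ?thesis
    by (simp add: shear_def radial_mean_nth smooth_translate smooth_grad_star axis_def)
      (simp add: grad_star_def axis_def)
qed

lemma dirderiv_shear_nth_star:
  assumes "b \<in> base" "c \<in> base"
  shows "dirderiv (axis c 1) (\<lambda>w. shear P w $ star b) w
    = (1/2) * (w $ cX)\<^sup>2 * radial_mean (\<lambda>s. (1 - s) * s)
        (\<lambda>w. dirderiv (axis c 1) (dirderiv (axis b 1) H) (P + w)) w"
proof -
  let ?G = "\<lambda>w. dirderiv (axis b 1) H (P + w)"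
  have sG: "smooth ?G" by (intro smooth_translate smooth_dirderiv smooth_H)
  have d: "dirderiv (axis c 1) ?G = (\<lambda>w. dirderiv (axis c 1) (dirderiv (axis b 1) H) (P + w))"
    by (rule ext) (rule dirderiv_affine_comp[OF bounded_linear_ident smooth_dirderiv[OF smooth_H]])
  have x: "dirderiv (axis c 1) (\<lambda>w::real^('n coord). w $ cX) w = 0"
    using dirderiv_nth[OF smooth_ident, of "axis c 1" cX w] axis_cX_base[OF assms(2)]
    by (simp add: dirderiv_def)
  show ?thesis
    unfolding shear_nth_star[OF assms(1)] power2_eq_square
    by (simp add: dirderiv_mult dirderiv_const dirderiv_divide x smooth_intros smooth_radial_mean sG
        dirderiv_radial_mean d)
qed

lemma symmetric_space_third_derivative:
  assumes "symmetric_space (gM f)" "b \<in> base" "c \<in> base"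
  shows "dirderivs [d, axis c 1, axis b 1] H P = 0"
proof -
  obtain \<phi> where \<phi>: "isometry (gM f) \<phi>" "\<phi> P = P" "\<And>v. frechet_derivative \<phi> (at P) v = - v"
    using assms(1) unfolding symmetric_space_def by blast
  have sm: "smooth \<phi>" using \<phi>(1) by (simp add: isometry_def diffeomorphism_def)
  have iso: "ginner (gM f) (\<phi> P) (dirderiv u \<phi> P) (dirderiv v \<phi> P) = ginner (gM f) P u v" for P u v
    using \<phi>(1) by (simp add: isometry_def dirderiv_def)
  \<comment> \<open>\<open>E\<close> is the starred deviation of the isometry from the affine
    reflection.\<close>
  define E where "E w = shear P w + shear P (- w)" for w
  have sm': "smooth (\<lambda>w. shear P (- w))"
    using smooth_affine_comp[OF bounded_linear_minus[OF bounded_linear_ident] smooth_shear[of P], of 0] by simp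
  have smE: "smooth E" unfolding E_def[abs_def] by (intro smooth_add smooth_shear sm')
  have form: "\<phi> (P + w) = P - w + E w" for w
    using point_reflection_formula[OF sm iso \<phi>(2)] \<phi>(3) by (simp add: dirderiv_def E_def)
  have D: "dirderiv u \<phi> (P + w) = - u + dirderiv u E w" for u w
  proof -
    have "dirderiv u \<phi> (P + w) = dirderiv u (\<lambda>w. \<phi> (P + w)) w"
      by (rule dirderiv_affine_comp[OF bounded_linear_ident sm, symmetric])
    also have "\<dots> = dirderiv u (\<lambda>w. P - w + E w) w" by (simp only: form)
    also have "\<dots> = - u + dirderiv u E w"
      by (rule dirderiv_eqI) (auto intro!: derivative_eq_intros smooth_has_derivative[OF smE])
    finally show ?thesis .
  qed
  have E0: "unstarred_part (dirderiv u E w) = 0" for u w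
    by (rule unstarred_part_dirderiv_adapted)
      (simp add: adapted_def smE, simp add: E_def unstarred_part_simps unstarred_part_shear shear_0)
  let ?b = "axis b 1 :: real^('n coord)" and ?c = "axis c 1 :: real^('n coord)"
  \<comment> \<open>For base directions the metric reduces to the flat form, and the pairing of two
    starred derivatives vanishes; so the isometry equation leaves the terms linear in
    \<open>E\<close>.\<close>
  have sum0: "dirderiv ?c E w $ star b + dirderiv ?b E w $ star c = 0" for w
    using iso[of "P + w" ?b ?c] E0 star_pairing_starred[OF E0 E0, of ?b w ?c w] assms(2,3)
    by (simp add: D ginner_gM star_pairing_simps unstarred_part_eq_0_iff axis_cX_base star_pairing_axis
        star_pairing_commute[of ?b "dirderiv ?c E w"])
  define K where "K = (\<lambda>w. dirderiv ?c (dirderiv ?b H) (P + w))"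
  have smK: "smooth K" unfolding K_def by (intro smooth_translate smooth_dirderiv smooth_H)
  define M where "M = radial_mean (\<lambda>s. (1 - s) * s) K"
  have cw: "continuous_on {0..1} (\<lambda>s::real. (1 - s) * s)" by (intro continuous_intros)
  have smM: "smooth M" unfolding M_def by (rule smooth_radial_mean[OF cw smK])
  have EK: "dirderiv (axis c' 1) E w $ star b' = (1/2) * (w $ cX)\<^sup>2 *
      (radial_mean (\<lambda>s. (1 - s) * s) (\<lambda>w. dirderiv (axis c' 1) (dirderiv (axis b' 1) H) (P + w)) w
       - radial_mean (\<lambda>s. (1 - s) * s) (\<lambda>w. dirderiv (axis c' 1) (dirderiv (axis b' 1) H) (P + w)) (- w))"
    if "b' \<in> base" "c' \<in> base" for b' c' w
  proof -
    let ?h = "\<lambda>w. shear P w $ star b'"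
    have sh: "smooth ?h" by (intro smooth_nth smooth_shear)
    have "dirderiv (axis c' 1) E w $ star b' = dirderiv (axis c' 1) (\<lambda>w. ?h w + ?h (0 + - w)) w"
      using dirderiv_nth[OF smE, of "axis c' 1" "star b'" w] by (simp add: E_def)
    also have "\<dots> = dirderiv (axis c' 1) ?h w + dirderiv (axis c' 1) (\<lambda>w. ?h (0 + - w)) w"
      by (intro dirderiv_add sh smooth_affine_comp[OF bounded_linear_minus[OF bounded_linear_ident] sh])
    also have "dirderiv (axis c' 1) (\<lambda>w. ?h (0 + - w)) w = dirderiv (- axis c' 1) ?h (0 + - w)"
      by (rule dirderiv_affine_comp[OF bounded_linear_minus[OF bounded_linear_ident] sh])
    also have "\<dots> = - dirderiv (axis c' 1) ?h (- w)"
      by (simp add: dirderiv_minus_dir[OF smooth_differentiable[OF sh]])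
    finally show ?thesis
      unfolding dirderiv_shear_nth_star[OF that] by (simp add: algebra_simps)
  qed
  \<comment> \<open>Second derivatives of \<open>H\<close> commute, so both entries in
    \<open>sum0\<close> are equal; with \<open>w $ cX = 1\<close> their common factor is a non-zero
    constant.\<close>
  have M1: "M w - M (- w) = 0" if "w $ cX = 1" for w
    using sum0[of w] EK[OF assms(2,3), of w] EK[OF assms(3,2), of w] that
    unfolding dirderiv_commute[OF smooth_H, of ?b ?c] K_def[symmetric] M_def[symmetric] by simp
  have bM: "base_only M" unfolding M_def K_def
    by (intro base_only_radial_mean base_only_translate base_only_dirderiv smooth_dirderiv smooth_H base_only_gM_xx)
  \<comment> \<open>\<open>M\<close> ignores the coordinate x, which can thus be set to 1 without
    changing either value.\<close>
  have M: "M w - M (0 + - w) = 0" for w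
  proof -
    let ?w = "w + (1 - w $ cX) *\<^sub>R axis cX 1"
    have "M w = M ?w" "M (- w) = M (- ?w)"
      by (rule base_onlyD[OF bM], auto simp: axis_def)+
    thus ?thesis using M1[of ?w] by (simp add: axis_def)
  qed
  have bl: "bounded_linear (\<lambda>w::real^('n coord). - w)" by (intro bounded_linear_minus bounded_linear_ident)
  \<comment> \<open>The difference is twice the odd part of \<open>M\<close>, and its derivative at
    0 is twice that of \<open>M\<close>.\<close>
  have "dirderiv d M 0 - dirderiv (- d) M (0 + - 0) = dirderiv d (\<lambda>w. M w - M (0 + - w)) 0"
    by (simp only: dirderiv_diff[OF smM smooth_affine_comp[OF bl smM]] dirderiv_affine_comp[OF bl smM])
  also have "\<dots> = 0" unfolding M by (rule dirderiv_const)
  finally have "dirderiv d M 0 = 0"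
    by (simp add: dirderiv_minus_dir[OF smooth_differentiable[OF smM]])
  \<comment> \<open>1/12 is the integral of \<open>(1 - s) s^2\<close>: the derivatives along
    \<open>axis c 1\<close> and \<open>d\<close> each contribute a factor \<open>s\<close> to the
    weight \<open>1 - s\<close>.\<close>
  moreover have "dirderiv d M 0 = (1/12) * dirderiv d K 0"
  proof -
    have "((\<lambda>s::real. (1 - s) * s * s) has_integral (1^3/3 - 1^4/4 - (0^3/3 - 0^4/4))) {0..1}"
      by (intro fundamental_theorem_of_calculus)
        (auto intro!: derivative_eq_intros simp flip: has_real_derivative_iff_has_vector_derivative
          simp: algebra_simps power2_eq_square power3_eq_cube)
    hence "integral {0..1} (\<lambda>s::real. (1 - s) * s * s) = 1/12" by (simp add: integral_unique)
    moreover have "continuous_on {0..1} (\<lambda>s::real. (1 - s) * s * s)" by (intro continuous_intros)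
    ultimately show ?thesis
      unfolding M_def dirderiv_radial_mean[OF cw smK] by (simp add: radial_mean_at_0 smooth_dirderiv smK)
  qed
  moreover have "dirderiv d K 0 = dirderiv d (dirderiv ?c (dirderiv ?b H)) P"
    unfolding K_def by (subst dirderiv_affine_comp[OF bounded_linear_ident]) (simp_all add: smooth_dirderiv smooth_H)
  ultimately show ?thesis by simp
qed

section \<open>Quadratic functions give symmetric spaces\<close>

lemma bounded_bilinear_Gam: "bounded_bilinear (Gam P)"
  unfolding bilinear_conv_bounded_bilinear[symmetric] bilinear_def
  by (intro conjI allI linearI)
    (simp_all add: Gam_def dirderiv_add_dir dirderiv_scaleR_dir diff_H algebra_simps)

lemma Gam_commute: "Gam P u v = Gam P v u"
  by (simp add: Gam_def algebra_simps)

text \<open>The products with the tilde coordinates are quadratic as well, so \<open>H\<close>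
  restricts to a polynomial of degree at most 2 on each line.\<close>

lemma at_most_quadratic_H_line:
  assumes "at_most_quadratic f"
  shows "\<exists>\<beta> \<gamma>. \<forall>t. H (P + t *\<^sub>R v) = H P + \<beta> * t + \<gamma> * t\<^sup>2"
proof -
  obtain c b A where f: "\<And>z. f z = c + (\<Sum>i\<in>UNIV. b i * z $ i) + (\<Sum>i\<in>UNIV. \<Sum>j\<in>UNIV. A i j * z $ i * z $ j)"
    using assms unfolding at_most_quadratic_def by blast
  define \<beta> where "\<beta> = -2 * ((\<Sum>i\<in>UNIV. b i * v $ cZ i)
    + (\<Sum>i\<in>UNIV. \<Sum>j\<in>UNIV. A i j * (P $ cZ i * v $ cZ j + v $ cZ i * P $ cZ j))
    + (\<Sum>i\<in>UNIV. P $ cZ i * v $ cT i + v $ cZ i * P $ cT i))"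
  define \<gamma> where "\<gamma> = -2 * ((\<Sum>i\<in>UNIV. \<Sum>j\<in>UNIV. A i j * v $ cZ i * v $ cZ j) + (\<Sum>i\<in>UNIV. v $ cZ i * v $ cT i))"
  have "H (P + t *\<^sub>R v) = H P + \<beta> * t + \<gamma> * t\<^sup>2" for t
    unfolding \<beta>_def \<gamma>_def gM_xx_def f
    by (simp add: algebra_simps sum.distrib sum_distrib_left sum_distrib_right power2_eq_square)
  thus ?thesis by blast
qed

lemma at_most_quadratic_symmetric_space:
  assumes "at_most_quadratic f"
  shows "symmetric_space (gM f)"
  unfolding symmetric_space_def
proof
  fix P :: "real^('n coord)"
  \<comment> \<open>For quadratic \<open>H\<close> the sum \<open>shear P w + shear P (- w)\<close>
    equals \<open>- Gam P w w\<close>, so this is the map of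
    \<open>point_reflection_formula\<close>.\<close>
  define s where "s Q = P - (Q - P) - Gam P (Q - P) (Q - P)" for Q
  interpret G: bounded_bilinear "Gam P" by (rule bounded_bilinear_Gam)
  have "smooth (\<lambda>Q. Gam P (Q - P) (Q - P))"
    using smooth_diff[OF smooth_ident smooth_const, of P] Ck_bilinear[OF bounded_bilinear_Gam]
    unfolding smooth_def by blast
  hence sm: "smooth s" unfolding s_def[abs_def] by (intro smooth_intros)
  have ss: "s (s Q) = Q" for Q
  proof -
    \<comment> \<open>\<open>Gam\<close> sees only the reflected unstarred part and is even in it,
      so \<open>s\<close> is its own inverse.\<close>
    have "Gam P (s Q - P) (s Q - P) = Gam P (- (Q - P)) (- (Q - P))"
      by (rule Gam_cong) (simp_all add: s_def unstarred_part_simps unstarred_part_Gam)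
    also have "\<dots> = Gam P (Q - P) (Q - P)" by (simp only: G.minus_left G.minus_right minus_minus)
    finally show ?thesis by (simp add: s_def[of "s Q"]) (simp add: s_def)
  qed
  have D: "frechet_derivative s (at Q) u = - u - 2 *\<^sub>R Gam P (Q - P) u" for Q u
  proof -
    have "(s has_derivative (\<lambda>u. - u - (Gam P (Q - P) u + Gam P u (Q - P)))) (at Q)"
      unfolding s_def[abs_def] by (auto intro!: derivative_eq_intros G.FDERIV)
    from dirderiv_eqI[OF this, of u] show ?thesis
      unfolding dirderiv_def by (simp add: Gam_commute[of P u] scaleR_2)
  qed
  have "ginner (gM f) (s Q) (frechet_derivative s (at Q) u) (frechet_derivative s (at Q) v) = ginner (gM f) Q u v" for Q u v
  proof -
    let ?w = "Q - P"
    obtain \<beta> \<gamma> where h: "\<And>t. H (P + t *\<^sub>R ?w) = H P + \<beta> * t + \<gamma> * t\<^sup>2"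
      using at_most_quadratic_H_line[OF assms] by blast
    have "((\<lambda>t. H (P + t *\<^sub>R ?w)) has_vector_derivative dirderiv ?w H (P + 0 *\<^sub>R ?w)) (at 0)"
      by (rule smooth_dirderiv_comp_line[OF smooth_H])
    moreover have "((\<lambda>t. H (P + t *\<^sub>R ?w)) has_vector_derivative \<beta>) (at 0)"
      unfolding h by (auto intro!: derivative_eq_intros simp flip: has_real_derivative_iff_has_vector_derivative)
    ultimately have \<beta>: "dirderiv ?w H P = \<beta>" using vector_derivative_unique_at by force
    have "H (s Q) = H (P + (-1) *\<^sub>R ?w)"
      using base_only_shift[OF base_only_gM_xx, of "- ?w - Gam P ?w ?w" "- ?w" f P]
      by (simp add: s_def unstarred_part_simps unstarred_part_Gam algebra_simps)
    \<comment> \<open>The even terms cancel in \<open>H (P + w) - H (P - w)\<close>; the linear ones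
      give exactly what the pairings with \<open>Gam\<close> add below.\<close>
    hence Hs: "H (s Q) + 2 * dirderiv ?w H P = H Q"
      using h[of "-1"] h[of 1] \<beta> by simp
    have gg: "star_pairing (Gam P ?w u) (Gam P ?w v) = 0"
      by (rule star_pairing_starred) (rule unstarred_part_Gam)+
    have "ginner (gM f) (s Q) (frechet_derivative s (at Q) u) (frechet_derivative s (at Q) v)
      = H (s Q) * u $ cX * v $ cX + star_pairing u v + 2 * (star_pairing u (Gam P ?w v) + star_pairing v (Gam P ?w u))"
      unfolding D ginner_gM star_pairing_simps gg
      by (simp add: Gam_nth_cX star_pairing_commute[of "Gam P ?w u" v])
    also have "\<dots> = (H (s Q) + 2 * dirderiv ?w H P) * u $ cX * v $ cX + star_pairing u v"
      unfolding star_pairing_Gam by (simp add: algebra_simps)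
    finally show ?thesis unfolding Hs ginner_gM .
  qed
  moreover have "diffeomorphism s" by (rule diffeomorphismI[OF sm sm ss ss])
  ultimately have "isometry (gM f) s" by (simp add: isometry_def)
  moreover have "s P = P" "\<forall>v. frechet_derivative s (at P) v = - v"
    by (simp_all add: D G.zero_left, simp add: s_def G.zero_left)
  ultimately show "\<exists>s. isometry (gM f) s \<and> s P = P \<and> (\<forall>v. frechet_derivative s (at P) v = - v)"
    by blast
qed

section \<open>Vanishing third derivatives and local symmetry\<close>

text \<open>Expansion along the axes acts on the outermost derivative, so Clairaut brings the three
  slots there one after another.\<close>

lemma third_derivative_eq_0:
  assumes "\<And>P b c d. {b, c, d} \<subseteq> base \<Longrightarrow> dirderivs [axis b 1, axis c 1, axis d 1] H P = 0"
  shows "dirderivs [u, v, w] H P = 0"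
proof -
  let ?e = "\<lambda>i. axis i 1 :: real^('n coord)"
  have 1: "dirderiv (?e i) (dirderiv (?e j) (dirderiv (?e k) H)) P = 0" for i j k P
  proof (cases "{i, j, k} \<subseteq> base")
    case True thus ?thesis using assms by simp
  next
    case False
    hence "\<exists>v\<in>set [?e i, ?e j, ?e k]. \<forall>c\<in>base. v $ c = 0" by (auto simp: axis_def)
    from dirderivs_eq_0[OF smooth_H base_only_gM_xx this] show ?thesis by simp
  qed
  have 2: "dirderiv u (dirderiv (?e j) (dirderiv (?e k) H)) P = 0" for u j k P
    by (subst dirderiv_expand) (simp_all add: 1 smooth_differentiable smooth_dirderiv smooth_H)
  have 3: "dirderiv u (dirderiv v (dirderiv (?e k) H)) P = 0" for u v k P
    unfolding dirderiv_commute[OF smooth_dirderiv[OF smooth_H], of u v]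
  proof (subst dirderiv_expand)
    show "(\<Sum>i\<in>UNIV. v $ i *\<^sub>R dirderiv (?e i) (dirderiv u (dirderiv (?e k) H)) P) = 0"
      unfolding dirderiv_commute[OF smooth_dirderiv[OF smooth_H], of _ u] 2 by simp
  qed (intro smooth_differentiable smooth_dirderiv smooth_H)
  have swap: "dirderiv v (dirderiv w H) = dirderiv w (dirderiv v H)" for v w
    by (rule ext) (rule dirderiv_commute[OF smooth_H])
  have "dirderivs [u, v, w] H P = dirderiv w (dirderiv u (dirderiv v H)) P"
    by (simp add: swap[of v w] dirderiv_commute[OF smooth_dirderiv[OF smooth_H], of u w])
  also have "\<dots> = (\<Sum>k\<in>UNIV. w $ k *\<^sub>R dirderiv (?e k) (dirderiv u (dirderiv v H)) P)"
    by (rule dirderiv_expand) (intro smooth_differentiable smooth_dirderiv smooth_H)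
  also have "\<dots> = 0"
  proof (intro sum.neutral ballI)
    fix k
    show "w $ k *\<^sub>R dirderiv (?e k) (dirderiv u (dirderiv v H)) P = 0"
      using 3[of u v k P]
      by (simp add: dirderiv_commute[OF smooth_dirderiv[OF smooth_H], of "?e k" u] swap[of "?e k" v])
  qed
  finally show ?thesis .
qed

text \<open>Taylor's formula for \<open>H\<close> on rays from 0 stops after degree 2. On the slice
  where the tilde coordinates vanish, \<open>H\<close> is \<open>-2 f\<close>, whence the divisors 2
  and 4.\<close>

lemma third_derivative_0_at_most_quadratic:
  assumes T: "\<And>u v w P. dirderivs [u, v, w] H P = 0"
  shows "at_most_quadratic f"
proof -
  let ?e = "\<lambda>i. axis (cZ i) 1 :: real^('n coord)"
  have taylor: "H v = H 0 + dirderiv v H 0 + dirderiv v (dirderiv v H) 0 / 2" for v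
  proof -
    have d: "((\<lambda>t. F (t *\<^sub>R v)) has_real_derivative dirderiv v F (t *\<^sub>R v)) (at t)"
      if "smooth F" for F :: "real^('n coord) \<Rightarrow> real" and t
      using smooth_radial_line[OF that] by (simp add: has_real_derivative_iff_has_vector_derivative)
    let ?d = "\<lambda>m t. dirderivs (replicate m v) H (t *\<^sub>R v)"
    have "(?d m has_real_derivative ?d (Suc m) t) (at t)" for m t
      using d[OF smooth_dirderivs[OF smooth_H, of "replicate m v"]] by simp
    hence "\<exists>t::real. 0 < t \<and> t < 1 \<and>
      H (1 *\<^sub>R v) = (\<Sum>m<3. ?d m 0 / fact m * 1 ^ m) + ?d 3 t / fact 3 * 1 ^ 3"
      by (intro Maclaurin[of 1 3 ?d "\<lambda>t. H (t *\<^sub>R v)"]) auto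
    moreover have "?d 3 t = 0" for t using T[of v v v "t *\<^sub>R v"] by (simp add: numeral_3_eq_3)
    ultimately show ?thesis by (auto simp: numeral_3_eq_3 numeral_2_eq_2)
  qed
  have quad: "f z = - H 0 / 2 + (\<Sum>i\<in>UNIV. - dirderiv (?e i) H 0 / 2 * z $ i)
    + (\<Sum>i\<in>UNIV. \<Sum>j\<in>UNIV. - dirderiv (?e j) (dirderiv (?e i) H) 0 / 4 * z $ i * z $ j)" for z
  proof -
    define v where "v = (\<Sum>i\<in>UNIV. z $ i *\<^sub>R ?e i)"
    have vZ: "v $ cZ i = z $ i" for i
      by (simp add: v_def axis_def if_distrib cong: if_cong)
    have vT: "v $ cT i = 0" for i by (simp add: v_def axis_def)
    have Hv: "H v = -2 * f z" by (simp add: gM_xx_def vZ vT)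
    have e: "dirderiv v F 0 = (\<Sum>i\<in>UNIV. z $ i * dirderiv (?e i) F 0)"
      if "smooth F" for F :: "real^('n coord) \<Rightarrow> real"
      unfolding v_def by (simp add: dirderiv_sum_dir dirderiv_scaleR_dir smooth_differentiable[OF that])
    have "dirderiv v (dirderiv v H) 0 = (\<Sum>i\<in>UNIV. z $ i * dirderiv v (dirderiv (?e i) H) 0)"
      by (subst e[OF smooth_dirderiv[OF smooth_H]], subst dirderiv_commute[OF smooth_H]) (rule refl)
    also have "\<dots> = (\<Sum>i\<in>UNIV. \<Sum>j\<in>UNIV. dirderiv (?e j) (dirderiv (?e i) H) 0 * z $ i * z $ j)"
      by (simp add: e[OF smooth_dirderiv[OF smooth_H]] sum_distrib_left mult_ac)
    finally have "-2 * f z = H 0 + (\<Sum>i\<in>UNIV. z $ i * dirderiv (?e i) H 0)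
        + (\<Sum>i\<in>UNIV. \<Sum>j\<in>UNIV. dirderiv (?e j) (dirderiv (?e i) H) 0 * z $ i * z $ j) / 2"
      using taylor[of v] e[OF smooth_H] Hv by simp
    thus ?thesis
      by (simp add: sum_divide_distrib sum_negf mult.commute field_simps flip: sum_divide_distrib)
  qed
  show ?thesis unfolding at_most_quadratic_def
    by (intro exI allI) (rule quad)
qed

text \<open>The component with indices \<open>cX, b, c, cX, d\<close> is a third derivative of
  \<open>H\<close> up to a factor, and every component is a combination of such derivatives.\<close>

lemma locally_symmetric_iff:
  "locally_symmetric (gM f) \<longleftrightarrow> (\<forall>u v w P. dirderivs [u, v, w] H P = 0)"
proof
  assume ls: "locally_symmetric (gM f)"
  have "dirderivs [axis b 1, axis c 1, axis d 1] H P = 0" if "{b, c, d} \<subseteq> base" for P b c d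
    using ls[unfolded locally_symmetric_def, rule_format, of "[cX, b, c, cX] @ [d]" P]
      nabla_Riem_comp_nonzero_values(1)[of "[d]" 1 b c P] that
    unfolding foldr_partial gM_cX_cX by simp
  thus "\<forall>u v w P. dirderivs [u, v, w] H P = 0" using third_derivative_eq_0 by blast
next
  assume T: "\<forall>u v w P. dirderivs [u, v, w] H P = 0"
  have "nabla_Riem_comp (gM f) 1 idx P = 0" if len: "length idx = 5" for idx P
  proof -
    have "length idx = 1 + 4" using len by simp
    then obtain i j k l es where idx: "idx = i # j # k # l # es" "length es = 1"
      by (rule length_ge_4_cases)
    then obtain m where "es = [m]" by (cases es) auto
    thus ?thesis using idx T by (subst nabla_Riem_comp_gM) (simp_all del: foldr.simps)
  qed
  thus "locally_symmetric (gM f)" by (simp add: locally_symmetric_def)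
qed

lemma symmetric_space_locally_symmetric:
  assumes "symmetric_space (gM f)"
  shows "locally_symmetric (gM f)"
  unfolding locally_symmetric_iff
  using third_derivative_eq_0 symmetric_space_third_derivative[OF assms] by simp

text \<open>A cycle of implications: quadratic \<open>f\<close> gives point reflections, these make
  the third derivatives of \<open>H\<close> vanish, which is local symmetry, and Taylor's formula
  leads back to quadratic \<open>f\<close>.\<close>

lemma symmetric_space_iff:
  "symmetric_space (gM f) \<longleftrightarrow> at_most_quadratic f" "locally_symmetric (gM f) \<longleftrightarrow> at_most_quadratic f"
  using at_most_quadratic_symmetric_space symmetric_space_locally_symmetric locally_symmetric_iff
    third_derivative_0_at_most_quadratic by blast+

end

text \<open>The last item is given for both customary meanings of a symmetric space: global point
  reflections and parallel curvature.\<close>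

theorem theorem1p6:
  fixes p :: nat and f :: "real^'n::finite \<Rightarrow> real"
  assumes "p \<ge> 1" and "CARD('n) = p + 1" and "smooth f"
  shows
    "geodesically_complete (gM f)
   \<and> (\<forall>P. exp_dom (gM f) P = UNIV \<and> diffeomorphism (exp_map (gM f) P))
   \<and> (\<forall>k P.
        (\<forall>b c es. length es = k \<and> {b, c} \<union> set es \<subseteq> range cZ \<union> range cT \<longrightarrow>
           (let r = - (1/2) * foldr partial (b # c # es) (\<lambda>Q. gM f Q $ cX $ cX) P in
              nabla_Riem_comp (gM f) k ([cX, b, c, cX] @ es) P = r
            \<and> nabla_Riem_comp (gM f) k ([b, cX, c, cX] @ es) P = - r
            \<and> nabla_Riem_comp (gM f) k ([cX, b, cX, c] @ es) P = - r
            \<and> nabla_Riem_comp (gM f) k ([b, cX, cX, c] @ es) P = r))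
      \<and> (\<forall>idx. length idx = k + 4 \<and>
           \<not> (\<exists>b c es. {b, c} \<union> set es \<subseteq> range cZ \<union> range cT \<and>
                idx \<in> {[cX, b, c, cX] @ es, [b, cX, c, cX] @ es,
                       [cX, b, cX, c] @ es, [b, cX, cX, c] @ es}) \<longrightarrow>
           nabla_Riem_comp (gM f) k idx P = 0))
   \<and> (\<forall>F \<in> weyl_invariants (gM f). \<forall>P. F P = 0)
   \<and> (symmetric_space (gM f) \<longleftrightarrow> at_most_quadratic f)
   \<and> (locally_symmetric (gM f) \<longleftrightarrow> at_most_quadratic f)"
proof -
  interpret smooth_gM f by unfold_locales (rule assms(3))
  show ?thesis
    unfolding Let_def base_def[symmetric]
    by (intro conjI allI impI ballI geodesically_complete_gM exp_dom_gM diffeomorphism_exp_map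
        nabla_Riem_comp_nonzero_values symmetric_space_iff)
      (use nabla_Riem_comp_nonzero_shape weyl_invariants_gM in blast)+
qed

end
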